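(* Assume: (A1) for each $j\in N$: (i) there exists $x^{s,*}_j$ with $f_j(x^{s,*}_j,0)=0$; (ii) for every constant $\bar\omega_j\in\mathbb{R}$, every compact invariant set of $\dot x^s_j=f_j(x^s_j,-\bar\omega_j)$ consists only of equilibrium points; (A2) there exists at least one bus $j\in N$ such that whenever $f_j(\bar x^s_j,-\bar\omega_j)=0$ for constants $\bar x^s_j,\bar\omega_j$, then $\bar\omega_j=0$. Let $z^*=(x^*,\sigma^* )$, $x^*=(\eta^*,\omega^*,x^{s,*})$, be an equilibrium of the hybrid system $\mathcal H=(C,f,D,g)$ (then $\omega^*=0$, $\sigma^*=0$) such that (A3) for each $j\in N$, the system $\dot x^s_j=f_j(x^s_j,u)$, $s_j=g_j(x^s_j,u)$ (input $u=-\omega_j$) is locally input strictly passive around the input $u=0$ and the point $x^{s,*}_j$, with a storage function $V^S_j$ having a strict local minimum at $x^{s,*}_j$; (A4) $|\eta^*_{ij}|<\pi/2$ for all $(i,j)\in E$. Then there exists an open neighborhood $S$ of $x^*$ such that every solution $z=(x,\sigma)$ of $\mathcal H$ with $x(0,0)\in S$ and $\sigma_j(0,0)\in\mathcal I_j(\omega_j(0,0))$ for all $j$ converges, as $t+\ell\to\infty$ along its hybrid time domain, to the set of equilibria of $\mathcal H$; in particular $\omega\to0_{|N|}$ and $\sigma\to0_{|N|}$.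
   Context: Network model. $(N,E)$ is a connected directed graph with $N=\{1,\dots,|N|\}$, $E\subseteq N\times N$, with arbitrary orientation: if $(i,j)\in E$ then $(j,i)\notin E$. For $j\in N$, "$i:i\to j$" ranges over $i$ with $(i,j)\in E$ and "$k:j\to k$" over $k$ with $(j,k)\in E$. Constants: $M_j>0$, $p^L_j\in\mathbb{R}$ ($j\in N$), $B_{ij}>0$ ($(i,j)\in E$). Continuous state $x=(\eta,\omega,x^s)\in\mathbb{R}^n$ with $\eta_{ij}\in\mathbb{R}$ ($(i,j)\in E$), $\omega_j\in\mathbb{R}$, $x^s_j\in\mathbb{R}^{n_j}$ ($j\in N$), $n=|E|+|N|+\sum_jn_j$; $p_{ij}=B_{ij}\sin\eta_{ij}$, $s_j=g_j(x^s_j,-\omega_j)$, where $f_j:\mathbb{R}^{n_j}\times\mathbb{R}\to\mathbb{R}^{n_j}$, $g_j:\mathbb{R}^{n_j}\times\mathbb{R}\to\mathbb{R}$ are globally Lipschitz. Hysteretic loads as a hybrid system. For each $j$ constants $\overline d_j\ge0$ and thresholds $\omega^1_j>\omega^0_j>0$ are given. ${\rm sgn}(a)=1$ if $a\ge0$ and $-1$ otherwise. The discrete state is $\sigma\in P^{|N|}$, $P=\{-1,0,1\}$, and $z=(x,\sigma)$. Let $\mathcal I_j(\omega_j)=\{{\rm sgn}(\omega_j)\}$ if $|\omega_j|>\omega^1_j$, $\{0\}$ if $|\omega_j|<\omega^0_j$, $\{0,{\rm sgn}(\omega_j)\}$ if $\omega^0_j\le|\omega_j|\le\omega^1_j$;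 $\Lambda=C=\{z\in\mathbb{R}^n\times P^{|N|}:\sigma_j\in\mathcal I_j(\omega_j)\ \forall j\}$. Flow map $f$ on $C$: $\dot\eta_{ij}=\omega_i-\omega_j$; $M_j\dot\omega_j=-p^L_j+s_j-\overline d_j\sigma_j-\sum_{k:j\to k}p_{jk}+\sum_{i:i\to j}p_{ij}$; $\dot x^s_j=f_j(x^s_j,-\omega_j)$; $\dot\sigma_j=0$. Jump set $D$: the set of $z\in\Lambda$ such that for some $j$, either ($|\omega_j|=\omega^1_j$ and $\sigma_j=0$) or ($|\omega_j|=\omega^0_j$ and $\sigma_j={\rm sgn}(\omega_j)$). Jump map $g$ on $D$: $x^+=x$; $\sigma_j^+={\rm sgn}(\omega_j)$ if $|\omega_j|=\omega^1_j$ and $\sigma_j=0$, $\sigma_j^+=0$ if $|\omega_j|=\omega^0_j$ and $\sigma_j={\rm sgn}(\omega_j)$, $\sigma_j^+=\sigma_j$ otherwise. A point $z^*$ is an equilibrium of $\mathcal H$ if $f(z^* )=0$ whenever $z^*\in C$ and $g(z^* )=z^*$ whenever $z^*\in D$. Hybrid solutions. A hybrid time domain is a subset $K\subseteq\mathbb{R}_{\ge0}\times\mathbb{N}_0$ that is a union of a finite or infinite sequence of sets $[t_\ell,t_{\ell+1}]\times\{\ell\}$ ($0=t_0\le t_1\le\dots$), the last one (if any) possibly of the form $[t_\ell,t_{\ell+1})\times\{\ell\}$ or $[t_\ell,\infty)\times\{\ell\}$. A solution of $\mathcal H$ is a map $z:K\to\mathbb{R}^n\times P^{|N|}$ on a hybrid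 time domain with $z(0,0)\in C\cup D$, such that for each $\ell$, $t\mapsto z(t,\ell)$ is locally absolutely continuous on $T_\ell=\{t:(t,\ell)\in K\}$, and if $T_\ell$ has nonempty interior then $z(t,\ell)\in C$ for all $t$ in the interior and $\dot z(t,\ell)=f(z(t,\ell))$ for almost all $t\in T_\ell$; and whenever $(t,\ell),(t,\ell+1)\in K$, $z(t,\ell)\in D$ and $z(t,\ell+1)=g(z(t,\ell))$. Solutions are taken maximal (not extendable to a solution on a strictly larger hybrid time domain). Passivity. The system $\dot x^s_j=f_j(x^s_j,u)$, $s_j=g_j(x^s_j,u)$ is locally input strictly passive around the constant input $\bar u$ and point $\bar x^s_j$ if there exist open neighborhoods $\Omega_j$ of $\bar u$ and $X^s_j$ of $\bar x^s_j$, a continuously differentiable positive semidefinite function $V^S_j:\mathbb{R}^{n_j}\to\mathbb{R}$ (storage function) and a positive definite function $\phi_j:\mathbb{R}\to\mathbb{R}$ such that for all $u\in\Omega_j$ and $x^s_j\in X^s_j$: $\frac{\partial V^S_j}{\partial x^s_j}(x^s_j)\,f_j(x^s_j,u)\le (u-\bar u)(g_j(x^s_j,u)-\bar s_j)-\phi_j(u-\bar u)$, where $\bar s_j=g_j(\bar x^s_j,\bar u)$. *)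

theory Defs
  imports "HOL-Analysis.Analysis"
begin

section \<open>Network data\<close>

text \<open>Buses are N = {1..nb}. The local state x^s_j of bus j lives in R^{n_j}; we
  model R^{n_j} as a linear subspace Ws j of a common Euclidean space 'a
  (dimension n_j = dim (Ws j)); the maps f_j, g_j are only used on Ws j.\<close>

record 'a net =
  nb   :: nat
  edges :: "(nat \<times> nat) set"
  Mc   :: "nat \<Rightarrow> real"
  pLc  :: "nat \<Rightarrow> real"
  Bc   :: "nat \<times> nat \<Rightarrow> real"
  Ws   :: "nat \<Rightarrow> 'a set"
  fs   :: "nat \<Rightarrow> 'a \<Rightarrow> real \<Rightarrow> 'a"
  gs   :: "nat \<Rightarrow> 'a \<Rightarrow> real \<Rightarrow> real"
  dbar :: "nat \<Rightarrow> real"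
  om0  :: "nat \<Rightarrow> real"
  om1  :: "nat \<Rightarrow> real"

definition buses :: "'a net \<Rightarrow> nat set" where
  "buses P = {1..nb P}"

definition network_ok :: "'a::euclidean_space net \<Rightarrow> bool" where
  "network_ok P \<longleftrightarrow>
     edges P \<subseteq> buses P \<times> buses P \<and>
     (\<forall>i j. (i, j) \<in> edges P \<longrightarrow> (j, i) \<notin> edges P) \<and>
     (\<forall>i\<in>buses P. \<forall>j\<in>buses P. (i, j) \<in> (edges P \<union> (edges P)\<inverse>)\<^sup>*) \<and>
     (\<forall>j\<in>buses P. Mc P j > 0) \<and>
     (\<forall>e\<in>edges P. Bc P e > 0) \<and>
     (\<forall>j\<in>buses P. dbar P j \<ge> 0 \<and> 0 < om0 P j \<and> om0 P j < om1 P j) \<and>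
     (\<forall>j\<in>buses P. subspace (Ws P j) \<and>
        (\<forall>x\<in>Ws P j. \<forall>u. fs P j x u \<in> Ws P j) \<and>
        (\<exists>L. lipschitz_on L (Ws P j \<times> UNIV) (\<lambda>(x, u). fs P j x u)) \<and>
        (\<exists>L. lipschitz_on L (Ws P j \<times> UNIV) (\<lambda>(x, u). gs P j x u)))"

section \<open>States\<close>

text \<open>z = (x, sigma), x = (eta, omega, x^s). Components outside E resp. N are
  kept at 0 (see state_space), so the state space is a copy of R^n.\<close>

type_synonym 'a hstate =
  "(((nat \<times> nat) \<Rightarrow> real) \<times> (nat \<Rightarrow> real) \<times> (nat \<Rightarrow> 'a)) \<times> (nat \<Rightarrow> int)"

type_synonym 'a cstate = "((nat \<times> nat) \<Rightarrow> real) \<times> (nat \<Rightarrow> real) \<times> (nat \<Rightarrow> 'a)"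

definition eta :: "'a hstate \<Rightarrow> (nat \<times> nat) \<Rightarrow> real" where "eta z = fst (fst z)"
definition omg :: "'a hstate \<Rightarrow> nat \<Rightarrow> real" where "omg z = fst (snd (fst z))"
definition xsv :: "'a hstate \<Rightarrow> nat \<Rightarrow> 'a" where "xsv z = snd (snd (fst z))"
definition sig :: "'a hstate \<Rightarrow> nat \<Rightarrow> int" where "sig z = snd z"

definition state_space :: "'a::euclidean_space net \<Rightarrow> 'a cstate set" where
  "state_space P = {(et, om, xs).
      (\<forall>e. e \<notin> edges P \<longrightarrow> et e = 0) \<and>
      (\<forall>j. j \<notin> buses P \<longrightarrow> om j = 0 \<and> xs j = 0) \<and>
      (\<forall>j\<in>buses P. xs j \<in> Ws P j)}"

section \<open>Hybrid system\<close>

definition hsgn :: "real \<Rightarrow> int" where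
  "hsgn a = (if a \<ge> 0 then 1 else -1)"

definition Iset :: "'a net \<Rightarrow> nat \<Rightarrow> real \<Rightarrow> int set" where
  "Iset P j w = (if \<bar>w\<bar> > om1 P j then {hsgn w}
                 else if \<bar>w\<bar> < om0 P j then {0}
                 else {0, hsgn w})"

text \<open>Lambda = C\<close>
definition Cset :: "'a::euclidean_space net \<Rightarrow> 'a hstate set" where
  "Cset P = {z. fst z \<in> state_space P \<and>
               (\<forall>j. j \<notin> buses P \<longrightarrow> sig z j = 0) \<and>
               (\<forall>j\<in>buses P. sig z j \<in> Iset P j (omg z j))}"

definition Dset :: "'a::euclidean_space net \<Rightarrow> 'a hstate set" where
  "Dset P = {z \<in> Cset P. \<exists>j\<in>buses P.
               (\<bar>omg z j\<bar> = om1 P j \<and> sig z j = 0) \<or>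
               (\<bar>omg z j\<bar> = om0 P j \<and> sig z j = hsgn (omg z j))}"

definition pflow :: "'a net \<Rightarrow> 'a hstate \<Rightarrow> nat \<times> nat \<Rightarrow> real" where
  "pflow P z e = Bc P e * sin (eta z e)"

definition flow_eta :: "'a net \<Rightarrow> 'a hstate \<Rightarrow> nat \<times> nat \<Rightarrow> real" where
  "flow_eta P z e = (if e \<in> edges P then omg z (fst e) - omg z (snd e) else 0)"

definition flow_om :: "'a::euclidean_space net \<Rightarrow> 'a hstate \<Rightarrow> nat \<Rightarrow> real" where
  "flow_om P z j = (if j \<in> buses P then
      (- pLc P j + gs P j (xsv z j) (- omg z j) - dbar P j * of_int (sig z j)
       - (\<Sum>k\<in>{k. (j, k) \<in> edges P}. pflow P z (j, k))
       + (\<Sum>i\<in>{i. (i, j) \<in> edges P}. pflow P z (i, j))) / Mc P j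
     else 0)"

definition flow_xs :: "'a::euclidean_space net \<Rightarrow> 'a hstate \<Rightarrow> nat \<Rightarrow> 'a" where
  "flow_xs P z j = (if j \<in> buses P then fs P j (xsv z j) (- omg z j) else 0)"

text \<open>The flow map f (the sigma-component of f is 0).\<close>
definition flowmap :: "'a::euclidean_space net \<Rightarrow> 'a hstate \<Rightarrow>
    (((nat \<times> nat) \<Rightarrow> real) \<times> (nat \<Rightarrow> real) \<times> (nat \<Rightarrow> 'a)) \<times> (nat \<Rightarrow> real)" where
  "flowmap P z = ((flow_eta P z, flow_om P z, flow_xs P z), (\<lambda>_. 0))"

definition jumpmap :: "'a::euclidean_space net \<Rightarrow> 'a hstate \<Rightarrow> 'a hstate" where
  "jumpmap P z = (fst z, (\<lambda>j.
      if j \<in> buses P \<and> \<bar>omg z j\<bar> = om1 P j \<and> sig z j = 0 then hsgn (omg z j)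
      else if j \<in> buses P \<and> \<bar>omg z j\<bar> = om0 P j \<and> sig z j = hsgn (omg z j) then 0
      else sig z j))"

text \<open>Equilibrium: a point of C \<union> D with f(z)=0 if z \<in> C and g(z)=z if z \<in> D.\<close>
definition equilibrium :: "'a::euclidean_space net \<Rightarrow> 'a hstate \<Rightarrow> bool" where
  "equilibrium P z \<longleftrightarrow> z \<in> Cset P \<union> Dset P \<and>
     (z \<in> Cset P \<longrightarrow> flowmap P z = ((\<lambda>_. 0, \<lambda>_. 0, \<lambda>_. 0), (\<lambda>_. 0))) \<and>
     (z \<in> Dset P \<longrightarrow> jumpmap P z = z)"

section \<open>Hybrid time domains and solutions\<close>

definition hybrid_time_domain :: "(real \<times> nat) set \<Rightarrow> bool" where
  "hybrid_time_domain K \<longleftrightarrow> (\<exists>tt :: nat \<Rightarrow> real. tt 0 = 0 \<and> mono tt \<and>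
     (K = (\<Union>l. {tt l..tt (Suc l)} \<times> {l}) \<or>
      (\<exists>J. K = (\<Union>l<J. {tt l..tt (Suc l)} \<times> {l}) \<union> ({tt J..tt (Suc J)} \<times> {J}) \<or>
           K = (\<Union>l<J. {tt l..tt (Suc l)} \<times> {l}) \<union> ({tt J..<tt (Suc J)} \<times> {J}) \<or>
           K = (\<Union>l<J. {tt l..tt (Suc l)} \<times> {l}) \<union> ({tt J..} \<times> {J}))))"

text \<open>Absolute continuity on an interval, and local absolute continuity on a set T
  (absolute continuity on every compact interval contained in T).\<close>
definition abs_cont_on :: "real set \<Rightarrow> (real \<Rightarrow> 'b::real_normed_vector) \<Rightarrow> bool" where
  "abs_cont_on I h \<longleftrightarrow> (\<forall>\<epsilon>>0. \<exists>\<delta>>0. \<forall>(n::nat) (a::nat \<Rightarrow> real) (b::nat \<Rightarrow> real).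
      (\<forall>k<n. a k \<le> b k \<and> {a k..b k} \<subseteq> I) \<and>
      (\<forall>k<n. \<forall>k'<n. k \<noteq> k' \<longrightarrow> {a k<..<b k} \<inter> {a k'<..<b k'} = {}) \<and>
      (\<Sum>k<n. b k - a k) < \<delta> \<longrightarrow> (\<Sum>k<n. norm (h (b k) - h (a k))) < \<epsilon>)"

definition loc_abs_cont_on :: "real set \<Rightarrow> (real \<Rightarrow> 'b::real_normed_vector) \<Rightarrow> bool" where
  "loc_abs_cont_on T h \<longleftrightarrow> (\<forall>a b. {a..b} \<subseteq> T \<longrightarrow> abs_cont_on {a..b} h)"

definition hsolution :: "'a::euclidean_space net \<Rightarrow> (real \<times> nat \<Rightarrow> 'a hstate) \<Rightarrow>
    (real \<times> nat) set \<Rightarrow> bool" where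
  "hsolution P z K \<longleftrightarrow> hybrid_time_domain K \<and> (0, 0) \<in> K \<and>
     z (0, 0) \<in> Cset P \<union> Dset P \<and>
     (\<forall>l. let T = {t. (t, l) \<in> K} in
        (\<forall>e\<in>edges P. loc_abs_cont_on T (\<lambda>t. eta (z (t, l)) e)) \<and>
        (\<forall>j\<in>buses P. loc_abs_cont_on T (\<lambda>t. omg (z (t, l)) j) \<and>
                      loc_abs_cont_on T (\<lambda>t. xsv (z (t, l)) j) \<and>
                      loc_abs_cont_on T (\<lambda>t. real_of_int (sig (z (t, l)) j))) \<and>
        (interior T \<noteq> {} \<longrightarrow>
           (\<forall>t\<in>interior T. z (t, l) \<in> Cset P) \<and>
           (AE t in lebesgue. t \<in> T \<longrightarrow>
              (\<forall>e\<in>edges P. ((\<lambda>s. eta (z (s, l)) e) has_real_derivative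
                               flow_eta P (z (t, l)) e) (at t within T)) \<and>
              (\<forall>j\<in>buses P.
                 ((\<lambda>s. omg (z (s, l)) j) has_real_derivative flow_om P (z (t, l)) j) (at t within T) \<and>
                 ((\<lambda>s. xsv (z (s, l)) j) has_vector_derivative flow_xs P (z (t, l)) j) (at t within T) \<and>
                 ((\<lambda>s. real_of_int (sig (z (s, l)) j)) has_real_derivative 0) (at t within T))))) \<and>
     (\<forall>t l. (t, l) \<in> K \<and> (t, Suc l) \<in> K \<longrightarrow>
        z (t, l) \<in> Dset P \<and> z (t, Suc l) = jumpmap P (z (t, l)))"

definition maximal_hsolution :: "'a::euclidean_space net \<Rightarrow> (real \<times> nat \<Rightarrow> 'a hstate) \<Rightarrow>
    (real \<times> nat) set \<Rightarrow> bool" where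
  "maximal_hsolution P z K \<longleftrightarrow> hsolution P z K \<and>
     \<not> (\<exists>z' K'. hsolution P z' K' \<and> K \<subset> K' \<and> (\<forall>p\<in>K. z' p = z p))"

text \<open>Distance on hybrid states (a norm-induced metric on the copy of
  R^n \<times> Z^|N| given by the relevant components).\<close>
definition zdist :: "'a::euclidean_space net \<Rightarrow> 'a hstate \<Rightarrow> 'a hstate \<Rightarrow> real" where
  "zdist P z w = (\<Sum>e\<in>edges P. \<bar>eta z e - eta w e\<bar>)
     + (\<Sum>j\<in>buses P. \<bar>omg z j - omg w j\<bar>)
     + (\<Sum>j\<in>buses P. norm (xsv z j - xsv w j))
     + (\<Sum>j\<in>buses P. real_of_int \<bar>sig z j - sig w j\<bar>)"

section \<open>Assumptions on the local subsystems\<close>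

text \<open>Two-sided invariance of K for xdot = F x on the space W.\<close>
definition invariant_set :: "'a::euclidean_space set \<Rightarrow> ('a \<Rightarrow> 'a) \<Rightarrow> 'a set \<Rightarrow> bool" where
  "invariant_set W F K \<longleftrightarrow> (\<forall>x0\<in>K. \<forall>\<phi> :: real \<Rightarrow> 'a.
     \<phi> 0 = x0 \<and> (\<forall>t. \<phi> t \<in> W) \<and> (\<forall>t. (\<phi> has_vector_derivative F (\<phi> t)) (at t))
     \<longrightarrow> (\<forall>t. \<phi> t \<in> K))"

definition posdef_fun :: "(real \<Rightarrow> real) \<Rightarrow> bool" where
  "posdef_fun \<phi> \<longleftrightarrow> \<phi> 0 = 0 \<and> (\<forall>u. u \<noteq> 0 \<longrightarrow> \<phi> u > 0)"

text \<open>Local input strict passivity of xdot = f(x,u), s = g(x,u) on the state space W,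
  around the constant input ubar and the point xbar, with storage function V.\<close>
definition lisp_storage :: "'a::euclidean_space set \<Rightarrow> ('a \<Rightarrow> real \<Rightarrow> 'a) \<Rightarrow>
    ('a \<Rightarrow> real \<Rightarrow> real) \<Rightarrow> real \<Rightarrow> 'a \<Rightarrow> ('a \<Rightarrow> real) \<Rightarrow> bool" where
  "lisp_storage W f g ubar xbar V \<longleftrightarrow>
     (\<exists>\<Omega> X \<phi> V'. open \<Omega> \<and> ubar \<in> \<Omega> \<and> openin (top_of_set W) X \<and> xbar \<in> X \<and>
        (\<forall>x. (V has_derivative blinfun_apply (V' x)) (at x)) \<and> continuous_on UNIV V' \<and>
        (\<forall>x\<in>W. V x \<ge> 0) \<and> posdef_fun \<phi> \<and>
        (\<forall>u\<in>\<Omega>. \<forall>x\<in>X. blinfun_apply (V' x) (f x u)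
            \<le> (u - ubar) * (g x u - g xbar ubar) - \<phi> (u - ubar)))"

definition strict_local_min_on :: "'a::euclidean_space set \<Rightarrow> ('a \<Rightarrow> real) \<Rightarrow> 'a \<Rightarrow> bool" where
  "strict_local_min_on W V xbar \<longleftrightarrow>
     (\<exists>\<epsilon>>0. \<forall>x\<in>W. 0 < dist x xbar \<and> dist x xbar < \<epsilon> \<longrightarrow> V xbar < V x)"

end

theory Submission
  imports Defs
begin

text \<open>
  The Lyapunov function is the sum of the edge potentials
  \<open>B (cos \<eta>* - cos \<eta> - (\<eta> - \<eta>*) sin \<eta>*)\<close>, the kinetic energies \<open>M \<omega>\<^sup>2 / 2\<close> and the storage functions.
  It is separable with a strict local minimum at the equilibrium, so it has a positive lower bound on the
  boundary of a small box around \<open>x*\<close>. If the box is chosen inside \<open>\<bar>\<omega>\<^sub>j\<bar> < \<omega>\<^sup>0\<^sub>j\<close>, a solution starting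
  in a small sublevel set has \<open>\<sigma> = 0\<close>, cannot leave the box and never jumps; if moreover its time domain is
  bounded, there is nothing to prove. Otherwise the solution is a continuously differentiable
  trajectory on \<open>[0, \<infinity>)\<close>, and no global existence result is needed.

  Along it, the Lyapunov function decreases at a uniformly continuous rate that is strictly negative
  where \<open>\<omega> \<noteq> 0\<close>, so Barbalat's lemma gives first \<open>\<omega> \<longrightarrow> 0\<close> and then \<open>\<omega>' \<longrightarrow> 0\<close>, that is, power
  balance at every limit point. Finally \<open>x\<^sup>s\<^sub>j\<close> solves an asymptotically autonomous equation, whose limit
  set is compact and invariant for \<open>x' = f\<^sub>j(x, 0)\<close>, hence consists of equilibria by (A1).
\<close>

section \<open>Absolutely continuous functions\<close>

text \<open>Barbalat is preferred to an invariance principle for the whole network because (A1)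
  concerns compact invariant sets of a single bus under a constant input: once every input tends to
  0, the buses can be studied one at a time. The passivity margin \<phi> is positive definite but
  need not be continuous; a uniform decay rate away from \<omega> = 0 is recovered from compactness
  of the box and continuity of \<open>rate\<close>. Two gaps shape the rest. Hybrid solutions
  satisfy the differential equation only almost everywhere, while the mean value arguments want it
  everywhere; with \<sigma> = 0 the right-hand side is continuous, and the fundamental theorem of
  calculus for absolutely continuous functions closes the gap. Moreover \<sigma> = 0 is itself a
  consequence of being in the box, so confinement is proved at the first exit time, where only the
  past is used. Limit points of a trajectory need not be unique; convergence to the set of
  equilibria is therefore shown by contradiction along subsequences.\<close>

lemma abs_cont_on_finite_family:
  fixes h :: "real \<Rightarrow> 'b::real_normed_vector"
  assumes "abs_cont_on I h" "\<epsilon> > 0"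
  shows "\<exists>\<delta>>0. \<forall>(A :: 'i set) u v. finite A \<longrightarrow> (\<forall>i\<in>A. u i \<le> v i \<and> {u i..v i} \<subseteq> I) \<longrightarrow>
       (\<forall>i\<in>A. \<forall>j\<in>A. i \<noteq> j \<longrightarrow> {u i<..<v i} \<inter> {u j<..<v j} = {}) \<longrightarrow>
       (\<Sum>i\<in>A. v i - u i) < \<delta> \<longrightarrow> (\<Sum>i\<in>A. norm (h (v i) - h (u i))) < \<epsilon>"
proof -
  have "\<exists>\<delta>>0. \<forall>(n::nat) (a::nat \<Rightarrow> real) (b::nat \<Rightarrow> real).
      (\<forall>k<n. a k \<le> b k \<and> {a k..b k} \<subseteq> I) \<and>
      (\<forall>k<n. \<forall>k'<n. k \<noteq> k' \<longrightarrow> {a k<..<b k} \<inter> {a k'<..<b k'} = {}) \<and>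
      (\<Sum>k<n. b k - a k) < \<delta> \<longrightarrow> (\<Sum>k<n. norm (h (b k) - h (a k))) < \<epsilon>"
    using assms(1)[unfolded abs_cont_on_def, THEN spec, THEN mp, OF assms(2)] .
  then obtain \<delta> where D0: "\<delta> > 0 \<and> (\<forall>(n::nat) (a::nat \<Rightarrow> real) (b::nat \<Rightarrow> real).
      (\<forall>k<n. a k \<le> b k \<and> {a k..b k} \<subseteq> I) \<and>
      (\<forall>k<n. \<forall>k'<n. k \<noteq> k' \<longrightarrow> {a k<..<b k} \<inter> {a k'<..<b k'} = {}) \<and>
      (\<Sum>k<n. b k - a k) < \<delta> \<longrightarrow> (\<Sum>k<n. norm (h (b k) - h (a k))) < \<epsilon>)" ..
  note d = D0[THEN conjunct1] and D = D0[THEN conjunct2, THEN spec, THEN spec, THEN spec, THEN mp]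
  show ?thesis
  proof (intro exI[of _ \<delta>] conjI d allI impI)
    fix A :: "'i set" and u v
    assume fin: "finite A" and le: "\<forall>i\<in>A. u i \<le> v i \<and> {u i..v i} \<subseteq> I"
      and dis: "\<forall>i\<in>A. \<forall>j\<in>A. i \<noteq> j \<longrightarrow> {u i<..<v i} \<inter> {u j<..<v j} = {}"
      and small: "(\<Sum>i\<in>A. v i - u i) < \<delta>"
    \<comment> \<open>The definition speaks of families indexed by an initial segment of the
      naturals; a bijection carries its modulus over to any finite set of tagged intervals.\<close>
    obtain f where f: "bij_betw f {0..<card A} A"
      using ex_bij_betw_nat_finite[OF fin] by blast
    then have f: "bij_betw f {..<card A} A" by (simp add: lessThan_atLeast0)
    have fA: "f k \<in> A" if "k < card A" for k using f that by (auto simp: bij_betw_def)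
    have fi: "f k \<noteq> f k'" if "k < card A" "k' < card A" "k \<noteq> k'" for k k'
      using f that by (auto simp: bij_betw_def inj_on_def)
    have "(\<Sum>k<card A. norm (h (v (f k)) - h (u (f k)))) < \<epsilon>"
    proof (rule D, intro conjI)
      show "(\<Sum>k<card A. v (f k) - u (f k)) < \<delta>"
        using small sum.reindex_bij_betw[OF f, of "\<lambda>i. v i - u i"] by simp
      show "\<forall>k<card A. u (f k) \<le> v (f k) \<and> {u (f k)..v (f k)} \<subseteq> I"
        using le fA by blast
      show "\<forall>k<card A. \<forall>k'<card A. k \<noteq> k' \<longrightarrow>
          {u (f k)<..<v (f k)} \<inter> {u (f k')<..<v (f k')} = {}"
        using dis fA fi by blast
    qed
    then show "(\<Sum>i\<in>A. norm (h (v i) - h (u i))) < \<epsilon>"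
      using sum.reindex_bij_betw[OF f, of "\<lambda>i. norm (h (v i) - h (u i))"] by simp
  qed
qed

text \<open>In the gauge sum, the intervals tagged in the exceptional null set have small total length, so
  absolute continuity makes their contribution small without any information on the derivative.\<close>

lemma has_integral_abs_cont:
  fixes h :: "real \<Rightarrow> 'b::real_normed_vector"
  assumes ac: "abs_cont_on {a..b} h" and ab: "a \<le> b" and N: "negligible N"
    and der: "\<And>t. t \<in> {a..b} - N \<Longrightarrow> (h has_vector_derivative f t) (at t within {a..b})"
  shows "(f has_integral (h b - h a)) {a..b}"
proof -
  \<comment> \<open>With the integrand set to 0 on \<open>N\<close>, a tag in \<open>N\<close>
    contributes only an increment of \<open>h\<close>. A spike argument undoes the change at the
    end.\<close>
  define f0 where "f0 t = (if t \<in> N then 0 else f t)" for t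
  have "(f0 has_integral (h b - h a)) {a..b}"
    unfolding has_integral_real
  proof (intro allI impI)
    fix e :: real assume e: "e > 0"
    \<comment> \<open>The summand 1 keeps the denominator positive also when \<open>a = b\<close>,
      and makes \<open>e1 * (b - a) < e / 2\<close> strict.\<close>
    define e1 where "e1 = e / 2 / (b - a + 1)"
    have e1: "e1 > 0" and e1b: "e1 * (b - a) < e / 2"
      using e ab by (auto simp: e1_def field_simps)
    from abs_cont_on_finite_family[OF ac half_gt_zero[OF e], where 'i = "real \<times> real set"]
    obtain \<delta> where D0: "\<delta> > 0 \<and> (\<forall>(A :: (real \<times> real set) set) u v. finite A \<longrightarrow> (\<forall>i\<in>A. u i \<le> v i \<and> {u i..v i} \<subseteq> {a..b}) \<longrightarrow>
       (\<forall>i\<in>A. \<forall>j\<in>A. i \<noteq> j \<longrightarrow> {u i<..<v i} \<inter> {u j<..<v j} = {}) \<longrightarrow>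
       (\<Sum>i\<in>A. v i - u i) < \<delta> \<longrightarrow> (\<Sum>i\<in>A. norm (h (v i) - h (u i))) < e / 2)" ..
    note d = D0[THEN conjunct1]
      and D = D0[THEN conjunct2, THEN spec, THEN spec, THEN spec, THEN mp, THEN mp, THEN mp, THEN mp]
    obtain U where U: "open U" "N \<subseteq> U" "U \<in> lmeasurable" "measure lebesgue U < \<delta>"
    proof -
      have Nn: "N \<in> null_sets lebesgue" using N negligible_iff_null_sets by blast
      then have Ns: "N \<in> sets lebesgue" by auto
      obtain T where T: "open T" "N \<subseteq> T" "T - N \<in> lmeasurable" "emeasure lebesgue (T - N) < ennreal \<delta>"
        using sets_lebesgue_outer_open[OF Ns d] by blast
      have "T = (T - N) \<union> N" using T by auto
      moreover have "N \<in> lmeasurable" using N negligible_imp_measurable by blast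
      ultimately have Tm: "T \<in> lmeasurable" using T(3) fmeasurable.Un by metis
      have "measure lebesgue T \<le> measure lebesgue (T - N) + measure lebesgue N"
        using \<open>T = (T - N) \<union> N\<close> measure_Un_le[of "T - N" lebesgue N] T(3) Ns
        by (metis fmeasurableD)
      also have "\<dots> < \<delta>"
        using T(3,4) d negligible_imp_measure0[OF N]
        by (simp add: emeasure_eq_measure2 ennreal_less_iff)
      finally show thesis using that T Tm by blast
    qed
    have "\<exists>r>0. \<forall>y\<in>{a..b}. norm (y - t) < r \<longrightarrow>
        norm (h y - h t - (y - t) *\<^sub>R f t) \<le> e1 * norm (y - t)" if "t \<in> {a..b} - N" for t
      using der[OF that] e1 unfolding has_vector_derivative_def has_derivative_within_alt by blast
    then obtain r where r: "\<And>t. t \<in> {a..b} - N \<Longrightarrow> r t > 0"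
      "\<And>t y. \<lbrakk>t \<in> {a..b} - N; y \<in> {a..b}; norm (y - t) < r t\<rbrakk> \<Longrightarrow>
        norm (h y - h t - (y - t) *\<^sub>R f t) \<le> e1 * norm (y - t)" by metis
    \<comment> \<open>Tags outside \<open>N\<close> get a ball in which the derivative estimate
      holds; tags in \<open>N\<close> force their interval into the small open set
      \<open>U\<close>.\<close>
    define \<gamma> where "\<gamma> t = (if t \<in> N then U else if t \<in> {a..b} then ball t (r t) else UNIV)" for t
    have gau: "gauge \<gamma>"
      using U r(1) by (auto simp: gauge_def \<gamma>_def)
    have main: "norm ((\<Sum>(x, k)\<in>p. measure lborel k *\<^sub>R f0 x) - (h b - h a)) < e"
      if p: "p tagged_division_of {a..b}" and fine: "\<gamma> fine p" for p
    proof -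
      have finp: "finite p" using p by auto
      note pD = tagged_division_ofD[OF p]
      have box: "k = {Inf k..Sup k} \<and> Inf k \<le> Sup k \<and> measure lborel k = Sup k - Inf k"
        if xk: "(x, k) \<in> p" for x k
      proof -
        obtain u v where k: "k = cbox u v" using pD(4)[OF xk] by blast
        moreover have "u \<le> v" using pD(2)[OF xk] k by auto
        ultimately show ?thesis by simp
      qed
      define p1 where "p1 = {i \<in> p. fst i \<in> N}"
      define p2 where "p2 = p - p1"
      have p12: "p = p1 \<union> p2" "p1 \<inter> p2 = {}" "finite p1" "finite p2" "p1 \<subseteq> p" "p2 \<subseteq> p"
        using finp by (auto simp: p1_def p2_def)
      let ?D = "\<lambda>(x, k). measure lborel k *\<^sub>R f0 x - (h (Sup k) - h (Inf k))"
      have "(\<Sum>(x, k)\<in>p. h (Sup k) - h (Inf k)) = h b - h a"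
        using additive_tagged_division_1[OF ab p, of h] by simp
      then have "(\<Sum>(x, k)\<in>p. measure lborel k *\<^sub>R f0 x) - (h b - h a) = sum ?D p"
        by (simp add: case_prod_unfold sum_subtractf)
      also have "\<dots> = sum ?D p1 + sum ?D p2"
        by (subst p12(1)) (rule sum.union_disjoint[OF p12(3,4,2)])
      finally have eq: "(\<Sum>(x, k)\<in>p. measure lborel k *\<^sub>R f0 x) - (h b - h a) = sum ?D p1 + sum ?D p2" .
      have "norm (sum ?D p2) \<le> (\<Sum>(x, k)\<in>p2. e1 * measure lborel k)"
      proof (rule sum_norm_le, clarify)
        fix x k assume xk: "(x, k) \<in> p2"
        then have xp: "(x, k) \<in> p" and xN: "x \<notin> N" by (auto simp: p1_def p2_def)
        define u v where "u = Inf k" and "v = Sup k"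
        then have uv: "k = {u..v}" "u \<le> v" "Inf k = u" "Sup k = v" "measure lborel k = v - u"
          using box[OF xp] by auto
        have xin: "x \<in> {u..v}" "{u..v} \<subseteq> {a..b}" using pD(2,3)[OF xp] uv by auto
        then have xab: "x \<in> {a..b} - N" using xN by auto
        have kb: "k \<subseteq> ball x (r x)"
        proof -
          have "k \<subseteq> \<gamma> x" using fine xp unfolding fine_def by blast
          also have "\<gamma> x = ball x (r x)" using xab by (simp add: \<gamma>_def)
          finally show ?thesis .
        qed
        have "v \<in> k" "u \<in> k" using uv by auto
        then have "norm (v - x) < r x" "norm (u - x) < r x" "v \<in> {a..b}" "u \<in> {a..b}"
          using kb uv(1) xin by (auto simp: subset_eq dist_norm norm_minus_commute simp del: real_norm_def)
        then have 1: "norm (h v - h x - (v - x) *\<^sub>R f x) \<le> e1 * (v - x)"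
          and 2: "norm (h u - h x - (u - x) *\<^sub>R f x) \<le> e1 * (x - u)"
          using r(2)[OF xab, of v] r(2)[OF xab, of u] xin by simp_all
        \<comment> \<open>Straddling: the interval is split at its tag, because the derivative
          estimate compares only with the value at \<open>x\<close>.\<close>
        have "measure lborel k *\<^sub>R f0 x - (h (Sup k) - h (Inf k))
            = (h u - h x - (u - x) *\<^sub>R f x) - (h v - h x - (v - x) *\<^sub>R f x)"
          using uv xN by (simp add: f0_def algebra_simps)
        then have "norm (measure lborel k *\<^sub>R f0 x - (h (Sup k) - h (Inf k)))
            \<le> e1 * (x - u) + e1 * (v - x)"
          using 1 2 norm_triangle_ineq4 by (smt (verit))
        then show "norm (measure lborel k *\<^sub>R f0 x - (h (Sup k) - h (Inf k))) \<le> e1 * measure lborel k"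
          using uv by (simp add: algebra_simps)
      qed
      also have "\<dots> \<le> (\<Sum>(x, k)\<in>p. e1 * measure lborel k)"
        using p12 e1 finp by (intro sum_mono2) auto
      also have "\<dots> = e1 * (b - a)"
        using additive_content_tagged_division[of p a b] p ab
        by (simp add: case_prod_unfold sum_distrib_left[symmetric])
      finally have n2: "norm (sum ?D p2) < e / 2" using e1b by simp
      have "norm (sum ?D p1) \<le> (\<Sum>i\<in>p1. norm (h (Sup (snd i)) - h (Inf (snd i))))"
        by (rule sum_norm_le) (auto simp: p1_def f0_def norm_minus_commute)
      also have "\<dots> < e / 2"
      proof (rule D)
        show "finite p1" by fact
        show "\<forall>i\<in>p1. Inf (snd i) \<le> Sup (snd i) \<and> {Inf (snd i)..Sup (snd i)} \<subseteq> {a..b}"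
        proof
          fix i assume "i \<in> p1"
          then have "(fst i, snd i) \<in> p" using p12 by auto
          then show "Inf (snd i) \<le> Sup (snd i) \<and> {Inf (snd i)..Sup (snd i)} \<subseteq> {a..b}"
            using box[of "fst i" "snd i"] pD(3)[of "fst i" "snd i"] by simp
        qed
        show "\<forall>i\<in>p1. \<forall>j\<in>p1. i \<noteq> j \<longrightarrow>
          {Inf (snd i)<..<Sup (snd i)} \<inter> {Inf (snd j)<..<Sup (snd j)} = {}"
        proof (intro ballI impI)
          fix i j assume "i \<in> p1" "j \<in> p1" and ne: "i \<noteq> j"
          then have ij: "(fst i, snd i) \<in> p" "(fst j, snd j) \<in> p" using p12 by auto
          have "interior (snd i) = {Inf (snd i)<..<Sup (snd i)}" if "(x, snd i) \<in> p" for i :: "real \<times> real set" and x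
            using box[OF that] interior_atLeastAtMost_real[of "Inf (snd i)" "Sup (snd i)"] by simp
          then show "{Inf (snd i)<..<Sup (snd i)} \<inter> {Inf (snd j)<..<Sup (snd j)} = {}"
            using pD(5)[OF ij] ij ne by (simp add: prod_eq_iff)
        qed
        \<comment> \<open>The intervals do not overlap, so their total length is the measure of
          their union, which lies in \<open>U\<close>.\<close>
        have part: "p1 tagged_partial_division_of {a..b}"
          by (rule tagged_partial_division_subset[OF p[unfolded tagged_division_of_def, THEN conjunct1] p12(5)])

        have "(\<Sum>i\<in>p1. Sup (snd i) - Inf (snd i)) = (\<Sum>(x, k)\<in>p1. measure lborel k)"
        proof (intro sum.cong refl, clarify)
          fix x k assume "(x, k) \<in> p1"
          then show "Sup (snd (x, k)) - Inf (snd (x, k)) = measure lborel k"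
            using box[of x k] p12(5) by auto
        qed
        also have "\<dots> = sum (measure lborel) (snd ` p1)"
          using sum.over_tagged_division_lemma[OF tagged_partial_division_of_Union_self[OF part], of "measure lborel"]
          by simp
        also have "\<dots> = sum (measure lebesgue) (snd ` p1)"
          using pD(4) p12(5) by (intro sum.cong) fastforce+
        also have "\<dots> = measure lebesgue (\<Union>(snd ` p1))"
          using content_division[OF partial_division_of_tagged_division[OF part]] by simp
        also have "\<dots> \<le> measure lebesgue U"
        proof (rule measure_mono_fmeasurable)
          show "\<Union> (snd ` p1) \<subseteq> U"
          proof (clarsimp simp: p1_def)
            fix x y k assume "(y, k) \<in> p" "y \<in> N" "x \<in> k"
            moreover from this have "k \<subseteq> \<gamma> y" using fine unfolding fine_def by blast
            ultimately show "x \<in> U" by (auto simp: \<gamma>_def)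
          qed
          show "\<Union> (snd ` p1) \<in> sets lebesgue"
          proof (rule sets.finite_Union)
            show "snd ` p1 \<subseteq> sets lebesgue"
              using pD(4) p12(5) by fastforce
          qed (use p12 in auto)
        qed (use U in auto)
        finally show "(\<Sum>i\<in>p1. Sup (snd i) - Inf (snd i)) < \<delta>" using U by simp
      qed
      finally have "norm (sum ?D p1) < e / 2" .
      with n2 show ?thesis unfolding eq
        using norm_triangle_ineq[of "sum ?D p1" "sum ?D p2"] by linarith
    qed
    show "\<exists>\<gamma>. gauge \<gamma> \<and> (\<forall>\<D>. \<D> tagged_division_of {a..b} \<and> \<gamma> fine \<D> \<longrightarrow>
        norm ((\<Sum>(x, k)\<in>\<D>. measure lborel k *\<^sub>R f0 x) - (h b - h a)) < e)"
      by (intro exI[of _ \<gamma>] conjI allI impI gau) (erule conjE, rule main)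
  qed
  then show ?thesis
    by (rule has_integral_spike[OF N, rotated]) (auto simp: f0_def)
qed

lemma continuous_on_abs_cont_on:
  assumes ac: "abs_cont_on {a..b} h"
  shows "continuous_on {a..b} h"
  unfolding continuous_on_iff
proof (intro ballI allI impI)
  fix x e :: real assume x: "x \<in> {a..b}" and e: "e > 0"
  from abs_cont_on_finite_family[OF ac e, where 'i = nat]
  obtain \<delta> where D0: "\<delta> > 0 \<and> (\<forall>(A :: nat set) u v. finite A \<longrightarrow> (\<forall>i\<in>A. u i \<le> v i \<and> {u i..v i} \<subseteq> {a..b}) \<longrightarrow>
       (\<forall>i\<in>A. \<forall>j\<in>A. i \<noteq> j \<longrightarrow> {u i<..<v i} \<inter> {u j<..<v j} = {}) \<longrightarrow>
       (\<Sum>i\<in>A. v i - u i) < \<delta> \<longrightarrow> (\<Sum>i\<in>A. norm (h (v i) - h (u i))) < e)" ..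
  note d = D0[THEN conjunct1]
    and D = D0[THEN conjunct2, THEN spec, THEN spec, THEN spec, THEN mp, THEN mp, THEN mp, THEN mp]
  have "norm (h v - h u) < e" if "u \<le> v" "{u..v} \<subseteq> {a..b}" "v - u < \<delta>" for u v
    using D[of "{0}" "\<lambda>_. u" "\<lambda>_. v"] that by auto
  then have "dist (h y) (h x) < e" if "y \<in> {a..b}" "dist y x < \<delta>" for y
    using that x by (cases "y \<le> x") (force simp: dist_norm norm_minus_commute)+
  then show "\<exists>d>0. \<forall>x'\<in>{a..b}. dist x' x < d \<longrightarrow> dist (h x') (h x) < e"
    using d by blast
qed

text \<open>Integrating the almost-everywhere derivative recovers \<open>h\<close>, so
  \<open>h\<close> is a primitive of the continuous \<open>f\<close> and is differentiable also at
  the exceptional points. This turns hybrid solutions into classical ones.\<close>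

lemma abs_cont_on_has_vector_derivative:
  fixes h :: "real \<Rightarrow> 'b::banach"
  assumes ac: "abs_cont_on {a..b} h" and cont: "continuous_on {a..b} f"
    and N: "negligible N"
    and der: "\<And>t. t \<in> {a..b} - N \<Longrightarrow> (h has_vector_derivative f t) (at t within {a..b})"
    and t: "t \<in> {a..b}"
  shows "(h has_vector_derivative f t) (at t within {a..b})"
proof -
  have sub: "abs_cont_on {a..s} h" if "s \<in> {a..b}" for s
  proof -
    have *: "{u..v} \<subseteq> {a..s} \<Longrightarrow> {u..v} \<subseteq> {a..b}" for u v using that by auto
    show ?thesis using ac unfolding abs_cont_on_def by (meson *)
  qed
  have hs: "h a + integral {a..s} f = h s" if s: "s \<in> {a..b}" for s
  proof -
    have "(f has_integral (h s - h a)) {a..s}"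
    proof (rule has_integral_abs_cont[OF sub[OF s] _ N])
      show "(h has_vector_derivative f t) (at t within {a..s})" if "t \<in> {a..s} - N" for t
        using der[of t] that s by (auto intro: has_vector_derivative_within_subset)
    qed (use s in auto)
    then show ?thesis by (simp add: integral_unique)
  qed
  have "((\<lambda>s. h a + integral {a..s} f) has_vector_derivative f t) (at t within {a..b})"
    using has_vector_derivative_add[OF has_vector_derivative_const
        integral_has_vector_derivative[OF cont t]] by simp
  then show ?thesis
    by (rule has_vector_derivative_transform[OF t, rotated]) (use hs in auto)
qed

section \<open>Asymptotic behaviour of trajectories\<close>

text \<open>A mean value of \<open>g\<close> just after \<open>t\<close> is a difference quotient of
  \<open>f\<close>, small because \<open>f\<close> converges; uniform continuity moves the bound
  from the mean point back to \<open>t\<close>.\<close>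

lemma barbalat:
  fixes f g :: "real \<Rightarrow> real"
  assumes der: "\<And>t. t \<ge> 0 \<Longrightarrow> (f has_real_derivative g t) (at t within {0..})"
    and lim: "(f \<longlongrightarrow> l) at_top"
    and uc: "uniformly_continuous_on {0..} g"
  shows "(g \<longlongrightarrow> 0) at_top"
proof (rule tendstoI)
  fix e :: real assume e: "e > 0"
  obtain d where d: "d > 0" and gd: "\<And>s t. \<lbrakk>s \<ge> 0; t \<ge> 0; dist s t < d\<rbrakk> \<Longrightarrow> dist (g s) (g t) < e / 2"
    using uc e unfolding uniformly_continuous_on_def by (metis half_gt_zero atLeast_iff)
  \<comment> \<open>Any step below the modulus \<open>d\<close> serves. The increment of
    \<open>f\<close> over it stays below \<open>e * c / 2\<close>, so the mean value of
    \<open>g\<close> is below \<open>e / 2\<close>.\<close>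
  define c where "c = d / 2"
  have c: "c > 0" "c < d" using d by (auto simp: c_def)
  have "\<forall>\<^sub>F t in at_top. dist (f t) l < e * c / 4"
    by (rule tendstoD[OF lim]) (use e c in simp)
  then obtain T where T: "\<And>t. t \<ge> T \<Longrightarrow> dist (f t) l < e * c / 4"
    by (auto simp: eventually_at_top_linorder)
  have "dist (g t) 0 < e" if t: "t \<ge> max T 0" for t
  proof -
    have "\<exists>x\<in>{t<..<t + c}. f (t + c) - f t = (\<lambda>y. g x * y) (t + c - t)"
    proof (rule mvt_simple)
      fix x assume "t \<le> x" "x \<le> t + c"
      then show "(f has_derivative (\<lambda>y. g x * y)) (at x within {t..t + c})"
        using has_field_derivative_subset[OF der[of x], of "{t..t + c}"] t
        unfolding has_field_derivative_def by auto
    qed (use c in simp)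
    then obtain x where x: "t < x" "x < t + c" "f (t + c) - f t = g x * c" by auto
    have "\<bar>f t - l\<bar> < e * c / 4" "\<bar>f (t + c) - l\<bar> < e * c / 4"
      using T[of t] T[of "t + c"] t c by (simp_all add: dist_real_def)
    then have "\<bar>g x * c\<bar> < e * c / 2"
      unfolding x(3)[symmetric] by linarith
    then have "\<bar>g x\<bar> * c < (e / 2) * c" using c by (simp add: abs_mult)
    then have "\<bar>g x\<bar> < e / 2" using c mult_less_cancel_right_pos by blast
    moreover have "dist (g t) (g x) < e / 2"
      using gd[of t x] t x c by (simp add: dist_real_def)
    ultimately show ?thesis unfolding dist_real_def by linarith
  qed
  then show "\<forall>\<^sub>F t in at_top. dist (g t) 0 < e"
    unfolding eventually_at_top_linorder by blast
qed

lemma decreasing_bounded_tendsto: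
  fixes f :: "real \<Rightarrow> real"
  assumes dec: "\<And>s t. \<lbrakk>0 \<le> s; s \<le> t\<rbrakk> \<Longrightarrow> f t \<le> f s" and bd: "\<And>t. t \<ge> 0 \<Longrightarrow> b \<le> f t"
  obtains l where "(f \<longlongrightarrow> l) at_top"
proof -
  define l where "l = Inf (f ` {0..})"
  have bb: "bdd_below (f ` {0..})" by (rule bdd_belowI2[of _ b]) (use bd in auto)
  have "(f \<longlongrightarrow> l) at_top"
  proof (rule tendstoI)
    fix e :: real assume "e > 0"
    then obtain T where T: "T \<ge> 0" "f T < l + e"
      using cInf_less_iff[of "f ` {0..}" "l + e"] bb unfolding l_def by auto
    have "dist (f t) l < e" if "t \<ge> T" for t
    proof -
      have "f t \<le> f T" using dec T that by blast
      moreover have "l \<le> f t" unfolding l_def using bb T that by (intro cInf_lower) auto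
      ultimately show ?thesis using T by (simp add: dist_real_def)
    qed
    then show "\<forall>\<^sub>F t in at_top. dist (f t) l < e"
      unfolding eventually_at_top_linorder by blast
  qed
  then show thesis by (rule that)
qed

text \<open>Finite induction: each new sequence costs one more extraction, and the earlier limits
  survive it.\<close>

lemma common_convergent_subseq:
  fixes f :: "'i \<Rightarrow> nat \<Rightarrow> 'b::heine_borel"
  assumes "finite I" "\<And>i. i \<in> I \<Longrightarrow> bounded (range (f i))"
  shows "\<exists>r. strict_mono r \<and> (\<forall>i\<in>I. convergent (f i \<circ> r))"
  using assms
proof (induction I rule: finite_induct)
  case empty
  show ?case by (intro exI[of _ id]) (auto simp: strict_mono_def)
next
  case (insert i I)
  then obtain r where r: "strict_mono r" "\<forall>i\<in>I. convergent (f i \<circ> r)" by blast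
  have "bounded (range (f i \<circ> r))"
    using insert.prems[of i] by (auto intro: bounded_subset)
  then obtain l s where s: "strict_mono (s :: nat \<Rightarrow> nat)" "((f i \<circ> r) \<circ> s) \<longlonglongrightarrow> l"
    using bounded_imp_convergent_subsequence by blast
  have "convergent (f k \<circ> (r \<circ> s))" if "k \<in> insert i I" for k
  proof (cases "k = i")
    case True
    then show ?thesis using s(2) by (auto simp: convergent_def o_assoc)
  next
    case False
    then have "convergent (f k \<circ> r)" using r that by auto
    then show ?thesis using convergent_subseq_convergent[OF _ s(1)] by (simp add: o_assoc)
  qed
  then show ?case using strict_mono_o[OF r(1) s(1)] by blast
qed

text \<open>The squared norm is differentiable even where the norm vanishes. As 2ne <= n^2 + e^2 for
  n = \<open>norm (y t - \<phi> t)\<close>, the derivative of n^2 is at most 3L(n^2 + e^2), so (n^2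
  + e^2) exp(-3Lt) does not increase.\<close>

lemma gronwall_perturbed:
  fixes y \<phi> :: "real \<Rightarrow> 'a::real_inner"
  assumes L: "L > 0" and T: "T \<ge> 0" and e: "e \<ge> 0"
    and y: "\<And>t. t \<in> {0..T} \<Longrightarrow> (y has_vector_derivative y' t) (at t within {0..T})"
    and \<phi>: "\<And>t. t \<in> {0..T} \<Longrightarrow> (\<phi> has_vector_derivative \<phi>' t) (at t within {0..T})"
    and lip: "\<And>t. t \<in> {0..T} \<Longrightarrow> norm (y' t - \<phi>' t) \<le> L * (norm (y t - \<phi> t) + e)"
  shows "(norm (y T - \<phi> T))\<^sup>2 \<le> ((norm (y 0 - \<phi> 0))\<^sup>2 + e\<^sup>2) * exp (3 * L * T)"
proof (cases "T = 0")
  case False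
  define u where "u t = (norm (y t - \<phi> t))\<^sup>2" for t
  define u' where "u' t = 2 * ((y t - \<phi> t) \<bullet> (y' t - \<phi>' t))" for t
  define v where "v t = (u t + e\<^sup>2) * exp (- (3 * L * t))" for t
  have ud: "(u has_real_derivative u' t) (at t within {0..T})" if "t \<in> {0..T}" for t
    unfolding u_def u'_def power2_norm_eq_inner has_real_derivative_iff_has_vector_derivative
    by (rule has_vector_derivative_eq_rhs, rule bounded_bilinear.has_vector_derivative[OF bounded_bilinear_inner],
        (rule has_vector_derivative_diff[OF y[OF that] \<phi>[OF that]])+) (simp add: inner_commute)
  have ub: "u' t \<le> 3 * L * (u t + e\<^sup>2)" if "t \<in> {0..T}" for t
  proof -
    let ?n = "norm (y t - \<phi> t)"
    have "u' t \<le> 2 * (?n * norm (y' t - \<phi>' t))"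
      unfolding u'_def using norm_cauchy_schwarz by simp
    also have "\<dots> \<le> 2 * (?n * (L * (?n + e)))"
      using lip[OF that] by (intro mult_left_mono) auto
    also have "\<dots> = L * (2 * ?n\<^sup>2 + 2 * ?n * e)" by (simp add: algebra_simps power2_eq_square)
    also have "\<dots> \<le> L * (3 * (?n\<^sup>2 + e\<^sup>2))"
    proof (rule mult_left_mono)
      have aux: "2 * A + C \<le> 3 * (A + B)" if "C \<le> A + B" "0 \<le> B" for A B C :: real
        using that by simp
      show "2 * ?n\<^sup>2 + 2 * ?n * e \<le> 3 * (?n\<^sup>2 + e\<^sup>2)"
        by (rule aux[OF sum_squares_bound]) simp
    qed (use L in simp)
    finally show ?thesis by (simp add: u_def algebra_simps)
  qed
  have vd: "(v has_real_derivative (u' t - 3 * L * (u t + e\<^sup>2)) * exp (- (3 * L * t))) (at t within {0..T})"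
    if "t \<in> {0..T}" for t
    unfolding v_def by (rule derivative_eq_intros ud[OF that] refl | simp add: algebra_simps)+
  have "\<exists>x\<in>{0<..<T}. v T - v 0 = (\<lambda>y. ((u' x - 3 * L * (u x + e\<^sup>2)) * exp (- (3 * L * x))) * y) (T - 0)"
    using vd T False unfolding has_field_derivative_def by (intro mvt_simple) auto
  then obtain x where "x \<in> {0<..<T}"
    and x2: "v T - v 0 = (u' x - 3 * L * (u x + e\<^sup>2)) * exp (- (3 * L * x)) * (T - 0)" by blast
  then have x1: "x \<in> {0..T}" by simp
  have "v T - v 0 \<le> 0"
    unfolding x2 using ub[OF x1] T by (intro mult_nonpos_nonneg) auto
  then have "(u T + e\<^sup>2) * exp (- (3 * L * T)) * exp (3 * L * T) \<le> (u 0 + e\<^sup>2) * exp (3 * L * T)"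
    unfolding v_def by (intro mult_right_mono) auto
  then have "u T + e\<^sup>2 \<le> (u 0 + e\<^sup>2) * exp (3 * L * T)"
    by (simp add: mult.assoc flip: exp_add)
  then show ?thesis using zero_le_power2[of e] unfolding u_def by linarith
qed simp

lemma lipschitz_on_pair_bound:
  assumes lip: "L-lipschitz_on (W \<times> UNIV) (\<lambda>(x, u). f x u)" and "x \<in> W" "y \<in> W"
  shows "dist (f x u) (f y v) \<le> L * (dist x y + dist u v)"
proof -
  have "dist (f x u) (f y v) \<le> L * dist (x, u) (y, v)"
    using lipschitz_onD[OF lip, of "(x, u)" "(y, v)"] assms(2,3) by simp
  also have "\<dots> \<le> L * (dist x y + dist u v)"
    using lipschitz_on_nonneg[OF lip]
    by (intro mult_left_mono) (simp_all add: dist_Pair_Pair sqrt_sum_squares_le_sum)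
  finally show ?thesis .
qed

text \<open>By the Gronwall estimate, the time shifts of \<open>y\<close> approach any given solution of the limit equation
  through a limit point, in both time directions. Hence the limit set \<open>K\<close> is invariant.\<close>

lemma asymptotic_limit_equilibrium:
  fixes y :: "real \<Rightarrow> 'a::euclidean_space"
  assumes W: "closed W"
    and lip: "L-lipschitz_on (W \<times> UNIV) (\<lambda>(x, u). f x u)"
    and ode: "\<And>t. t \<ge> 0 \<Longrightarrow> (y has_vector_derivative f (y t) (u t)) (at t within {0..})"
    and yW: "\<And>t. t \<ge> 0 \<Longrightarrow> y t \<in> W"
    and bd: "bounded (y ` {0..})"
    and u: "(u \<longlongrightarrow> (0::real)) at_top"
    and inv: "\<And>K. \<lbrakk>K \<subseteq> W; compact K; invariant_set W (\<lambda>x. f x 0) K\<rbrakk> \<Longrightarrow> \<forall>x\<in>K. f x 0 = 0"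
    and s: "filterlim s at_top sequentially" and lim: "(\<lambda>n. y (s n)) \<longlonglongrightarrow> x"
  shows "f x 0 = 0"
proof -
  \<comment> \<open>The omega-limit set of \<open>y\<close>: closed by construction, and compact
    because \<open>y\<close> is bounded.\<close>
  define K where "K = (\<Inter>T\<in>{0..}. closure (y ` {T..}))"
  have K_iff: "z \<in> K \<longleftrightarrow> (\<forall>T\<ge>0. \<forall>e>0. \<exists>t\<ge>T. dist (y t) z < e)" for z
    unfolding K_def by (auto simp: closure_approachable)
  have K0: "K \<subseteq> closure (y ` {0..})" unfolding K_def by auto
  have "K \<subseteq> W"
    using K0 closure_minimal[of "y ` {0..}" W] yW W by fastforce
  moreover have "compact K"
    unfolding compact_eq_bounded_closed
  proof
    show "bounded K" using K0 bd bounded_closure bounded_subset by blast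
    show "closed K" unfolding K_def by auto
  qed
  moreover have "invariant_set W (\<lambda>x. f x 0) K"
    unfolding invariant_set_def
  proof (intro ballI allI impI, elim conjE)
    fix x0 \<phi> and \<tau> :: real
    assume x0: "x0 \<in> K" and \<phi>0: "\<phi> 0 = x0" and \<phi>W: "\<forall>t. \<phi> t \<in> W"
      and \<phi>': "\<forall>t::real. (\<phi> has_vector_derivative f (\<phi> t) 0) (at t)"
    define S where "S = \<bar>\<tau>\<bar>"
    \<comment> \<open>The sign lets one forward estimate on \<open>{0..S}\<close> cover both time
      directions, with time running as \<open>\<sigma> * r\<close>.\<close>
    define \<sigma> :: real where "\<sigma> = (if \<tau> \<ge> 0 then 1 else -1)"
    have \<sigma>: "\<bar>\<sigma>\<bar> = 1" "\<tau> = \<sigma> * S" "S \<ge> 0" by (auto simp: \<sigma>_def S_def)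
    \<comment> \<open>The Gronwall estimate wants a positive constant.\<close>
    define L1 where "L1 = L + 1"
    have L1: "L1 > 0" "L \<le> L1" "L \<ge> 0" using lipschitz_on_nonneg[OF lip] by (auto simp: L1_def)
    show "\<phi> \<tau> \<in> K"
      unfolding K_iff
    proof (intro allI impI)
      fix T e :: real assume T: "T \<ge> 0" and e: "e > 0"
      \<comment> \<open>Chosen so that \<epsilon>^2 times the growth factor is e^2/4; the initial
        error and the input error contribute one such share each.\<close>
      define \<epsilon> where "\<epsilon> = e / 2 * exp (- (3 * L1 * S) / 2)"
      have \<epsilon>: "\<epsilon> > 0" using e by (simp add: \<epsilon>_def)
      have "exp (- (3 * L1 * S) / 2) ^ 2 * exp (3 * L1 * S) = 1"
        by (simp add: power2_eq_square flip: exp_add)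
      then have "\<epsilon>\<^sup>2 * exp (3 * L1 * S) = (e / 2)\<^sup>2"
        unfolding \<epsilon>_def power_mult_distrib by (simp add: mult.assoc)
      then have "\<epsilon>\<^sup>2 * exp (3 * L1 * S) = e\<^sup>2 / 4"
        by (simp add: power_divide)
      then have \<epsilon>e: "(\<epsilon>\<^sup>2 + \<epsilon>\<^sup>2) * exp (3 * L1 * S) < e\<^sup>2"
        using zero_less_power[OF e, of 2] unfolding distrib_right by linarith
      obtain T0 where T0: "\<And>t. t \<ge> T0 \<Longrightarrow> \<bar>u t\<bar> < \<epsilon>"
        using tendstoD[OF u \<epsilon>] by (auto simp: eventually_at_top_linorder)
      \<comment> \<open>The extra \<open>S\<close> keeps the whole window, also when run backwards,
        beyond \<open>T0\<close>, where the input is small, and beyond \<open>T\<close>.\<close>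
      obtain t where t: "t \<ge> max T0 T + S" and yt: "dist (y t) x0 < \<epsilon>"
        using x0[unfolded K_iff, rule_format, of "max T0 T + S" \<epsilon>] \<epsilon> T \<sigma>(3) by auto
      have "(norm (y (t + \<sigma> * S) - \<phi> (\<sigma> * S)))\<^sup>2
          \<le> ((norm (y (t + \<sigma> * 0) - \<phi> (\<sigma> * 0)))\<^sup>2 + \<epsilon>\<^sup>2) * exp (3 * L1 * S)"
      proof (rule gronwall_perturbed[OF L1(1) \<sigma>(3)])
        fix r assume r: "r \<in> {0..S}"
        have ge: "t + \<sigma> * q \<ge> max T0 T" if "q \<in> {0..S}" for q
          using that t by (auto simp: \<sigma>_def)
        have aff: "((\<lambda>r. t + \<sigma> * r) has_vector_derivative \<sigma>) (at r within {0..S})"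
          unfolding has_real_derivative_iff_has_vector_derivative[symmetric]
          by (auto intro!: derivative_eq_intros)
        have "(y has_vector_derivative f (y (t + \<sigma> * r)) (u (t + \<sigma> * r)))
            (at (t + \<sigma> * r) within (\<lambda>r. t + \<sigma> * r) ` {0..S})"
          by (rule has_vector_derivative_within_subset[OF ode]) (use ge r T in force)+
        then show "((\<lambda>r. y (t + \<sigma> * r)) has_vector_derivative \<sigma> *\<^sub>R f (y (t + \<sigma> * r)) (u (t + \<sigma> * r)))
            (at r within {0..S})"
          using vector_diff_chain_within[OF aff] by (simp add: o_def)
        have aff': "((\<lambda>r. \<sigma> * r) has_vector_derivative \<sigma>) (at r within {0..S})"
          unfolding has_real_derivative_iff_has_vector_derivative[symmetric]
          by (auto intro!: derivative_eq_intros)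
        show "((\<lambda>r. \<phi> (\<sigma> * r)) has_vector_derivative \<sigma> *\<^sub>R f (\<phi> (\<sigma> * r)) 0) (at r within {0..S})"
          using vector_diff_chain_within[OF aff' has_vector_derivative_at_within[OF \<phi>'[rule_format]]]
          by (simp add: o_def)
        let ?y = "y (t + \<sigma> * r)" and ?p = "\<phi> (\<sigma> * r)" and ?u = "u (t + \<sigma> * r)"
        have "norm (\<sigma> *\<^sub>R f ?y ?u - \<sigma> *\<^sub>R f ?p 0) = dist (f ?y ?u) (f ?p 0)"
          unfolding scaleR_diff_right[symmetric] norm_scaleR \<sigma>(1) by (simp add: dist_norm)
        also have "\<dots> \<le> L * (dist ?y ?p + dist ?u 0)"
          using ge[OF r] T yW \<phi>W by (intro lipschitz_on_pair_bound[OF lip]) auto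
        also have "\<dots> \<le> L1 * (norm (?y - ?p) + \<epsilon>)"
          using T0[of "t + \<sigma> * r"] ge[OF r] L1 by (intro mult_mono) (auto simp: dist_norm)
        finally show "norm (\<sigma> *\<^sub>R f ?y ?u - \<sigma> *\<^sub>R f ?p 0) \<le> L1 * (norm (?y - ?p) + \<epsilon>)" .
      qed (use \<epsilon> in auto)
      also have "\<dots> \<le> (\<epsilon>\<^sup>2 + \<epsilon>\<^sup>2) * exp (3 * L1 * S)"
        using yt \<phi>0 by (intro mult_right_mono add_right_mono power_mono) (auto simp: dist_norm)
      also have "\<dots> < e\<^sup>2" by (rule \<epsilon>e)
      finally have "norm (y (t + \<tau>) - \<phi> \<tau>) < e"
        using e unfolding \<sigma>(2)[symmetric] by (simp add: power2_less_imp_less)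
      moreover have "t + \<tau> \<ge> T" using t unfolding S_def by linarith
      ultimately show "\<exists>t\<ge>T. dist (y t) (\<phi> \<tau>) < e" by (auto simp: dist_norm)
    qed
  qed
  ultimately have "\<forall>x\<in>K. f x 0 = 0" by (rule inv)
  moreover have "x \<in> K"
    unfolding K_iff
  proof (intro allI impI)
    fix T e :: real assume "e > 0"
    have "\<forall>\<^sub>F n in sequentially. s n \<ge> T" using s by (simp add: filterlim_at_top)
    moreover have "\<forall>\<^sub>F n in sequentially. dist (y (s n)) x < e" by (rule tendstoD[OF lim \<open>e > 0\<close>])
    ultimately have "\<forall>\<^sub>F n in sequentially. s n \<ge> T \<and> dist (y (s n)) x < e"
      by (rule eventually_conj)
    then show "\<exists>t\<ge>T. dist (y t) x < e"
      using eventually_happens'[OF sequentially_bot] by fast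
  qed
  ultimately show ?thesis by blast
qed

section \<open>The Lyapunov function\<close>

text \<open>Edges are grouped by their tail. This is the summation by parts behind the cancellation
  of the transmitted power.\<close>

lemma sum_over_edges_fst:
  fixes w :: "'v \<Rightarrow> real"
  assumes "finite N" "E \<subseteq> N \<times> N"
  shows "(\<Sum>j\<in>N. w j * (\<Sum>k\<in>{k. (j, k) \<in> E}. D (j, k))) = (\<Sum>e\<in>E. w (fst e) * D e)"
proof -
  have E: "E = Sigma N (\<lambda>j. {k. (j, k) \<in> E})" using assms(2) by auto
  have fin: "finite {k. (j, k) \<in> E}" for j
    by (rule finite_subset[OF _ assms(1)]) (use assms(2) in auto)
  have "(\<Sum>j\<in>N. w j * (\<Sum>k\<in>{k. (j, k) \<in> E}. D (j, k)))
      = (\<Sum>(j, k)\<in>Sigma N (\<lambda>j. {k. (j, k) \<in> E}). w j * D (j, k))"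
    unfolding sum_distrib_left by (rule sum.Sigma) (use assms fin in auto)
  also have "\<dots> = (\<Sum>e\<in>E. w (fst e) * D e)"
    unfolding E[symmetric] by (simp add: case_prod_unfold)
  finally show ?thesis .
qed

text \<open>The same regrouping, applied to the reversed graph.\<close>

lemma sum_over_edges_snd:
  fixes w :: "'v \<Rightarrow> real"
  assumes "finite N" "E \<subseteq> N \<times> N"
  shows "(\<Sum>j\<in>N. w j * (\<Sum>i\<in>{i. (i, j) \<in> E}. D (i, j))) = (\<Sum>e\<in>E. w (snd e) * D e)"
proof -
  have "(\<Sum>j\<in>N. w j * (\<Sum>i\<in>{i. (i, j) \<in> E}. D (i, j)))
      = (\<Sum>e\<in>E\<inverse>. w (fst e) * D (snd e, fst e))"
    using sum_over_edges_fst[OF assms(1), of "E\<inverse>" w "\<lambda>e. D (snd e, fst e)"] assms(2) by auto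
  also have "\<dots> = (\<Sum>e\<in>E. w (snd e) * D e)"
    by (rule sum.reindex_bij_witness[of _ "\<lambda>(a, b). (b, a)" "\<lambda>(a, b). (b, a)"]) auto
  finally show ?thesis .
qed

text \<open>The Bregman divergence of \<open>- cos\<close> at \<open>a\<close>; its derivative in
  \<open>x\<close> is \<open>sin x - sin a\<close>.\<close>

definition edge_energy :: "real \<Rightarrow> real \<Rightarrow> real" where
  "edge_energy a x = cos a - cos x - (x - a) * sin a"

text \<open>Sine is strictly increasing between -pi/2 and pi/2, so the derivative has the sign of
  \<open>x - a\<close>.\<close>

lemma edge_energy_pos:
  assumes a: "\<bar>a\<bar> < pi / 2" and x: "\<bar>x\<bar> < pi / 2" and ne: "x \<noteq> a"
  shows "edge_energy a x > 0"
proof -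
  have der: "(edge_energy a has_real_derivative (sin y - sin a)) (at y)" for y
    unfolding edge_energy_def by (auto intro!: derivative_eq_intros)
  have sin_less: "sin p < sin q" if "\<bar>p\<bar> < pi / 2" "\<bar>q\<bar> < pi / 2" "p < q" for p q :: real
    using that by (intro sin_monotone_2pi) auto
  have cont: "continuous_on S (edge_energy a)" for S
    unfolding edge_energy_def by (intro continuous_intros)
  have zero: "edge_energy a a = 0" by (simp add: edge_energy_def)
  show ?thesis
  proof (cases "x > a")
    case True
    have "edge_energy a a < edge_energy a x"
    proof (rule DERIV_pos_imp_increasing_open[OF True _ cont])
      fix y assume "a < y" "y < x"
      then show "\<exists>d. DERIV (edge_energy a) y :> d \<and> d > 0"
        using der[of y] sin_less[of a y] a x by force
    qed
    then show ?thesis using zero by simp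
  next
    case False
    then have "x < a" using ne by simp
    have "edge_energy a a < edge_energy a x"
    proof (rule DERIV_neg_imp_decreasing_open[OF \<open>x < a\<close> _ cont])
      fix y assume "x < y" "y < a"
      then show "\<exists>d. DERIV (edge_energy a) y :> d \<and> d < 0"
        using der[of y] sin_less[of y a] a x by force
    qed
    then show ?thesis using zero by simp
  qed
qed

text \<open>The differential equation in the classical sense, at every time and one-sided at the
  ends of an interval. \<sigma> is left out because it is held at 0 wherever this is
  applied.\<close>

definition flows_on :: "'a::euclidean_space net \<Rightarrow> (real \<Rightarrow> 'a hstate) \<Rightarrow> real set \<Rightarrow> bool" where
  "flows_on P z I \<longleftrightarrow> (\<forall>t\<in>I.
     (\<forall>e\<in>edges P. ((\<lambda>s. eta (z s) e) has_real_derivative flow_eta P (z t) e) (at t within I)) \<and>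
     (\<forall>j\<in>buses P. ((\<lambda>s. omg (z s) j) has_real_derivative flow_om P (z t) j) (at t within I) \<and>
        ((\<lambda>s. xsv (z s) j) has_vector_derivative flow_xs P (z t) j) (at t within I)))"

text \<open>One radius \<open>R\<close> serves all buses and edges: within it the hysteresis is
  inactive by \<open>R_om\<close>, sine is increasing by \<open>R_eta\<close>, and passivity and
  strict minimality hold. The input is \<open>- w\<close>, so the supply term of passivity appears
  on the left with a plus sign; of the margin only the sign is recorded.\<close>

locale passive_network =
  fixes P :: "'a::euclidean_space net" and zs :: "'a hstate"
    and V :: "nat \<Rightarrow> 'a \<Rightarrow> real" and V' :: "nat \<Rightarrow> 'a \<Rightarrow> 'a \<Rightarrow>\<^sub>L real" and R :: real
  assumes net: "network_ok P"
    and om_eq: "j \<in> buses P \<Longrightarrow> omg zs j = 0"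
    and xs_W: "j \<in> buses P \<Longrightarrow> xsv zs j \<in> Ws P j"
    and balance: "j \<in> buses P \<Longrightarrow> - pLc P j + gs P j (xsv zs j) 0
       - (\<Sum>k\<in>{k. (j, k) \<in> edges P}. pflow P zs (j, k))
       + (\<Sum>i\<in>{i. (i, j) \<in> edges P}. pflow P zs (i, j)) = 0"
    and R_pos: "R > 0"
    and R_om: "j \<in> buses P \<Longrightarrow> R < om0 P j"
    and R_eta: "e \<in> edges P \<Longrightarrow> \<bar>eta zs e\<bar> + R < pi / 2"
    and V_deriv: "j \<in> buses P \<Longrightarrow> (V j has_derivative blinfun_apply (V' j x)) (at x)"
    and V'_cont: "j \<in> buses P \<Longrightarrow> continuous_on UNIV (V' j)"
    and V_min: "\<lbrakk>j \<in> buses P; x \<in> Ws P j; x \<noteq> xsv zs j; dist x (xsv zs j) \<le> R\<rbrakk>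
       \<Longrightarrow> V j (xsv zs j) < V j x"
    and dissip: "\<lbrakk>j \<in> buses P; x \<in> Ws P j; dist x (xsv zs j) \<le> R; \<bar>w\<bar> \<le> R\<rbrakk>
       \<Longrightarrow> blinfun_apply (V' j x) (fs P j x (- w)) + w * (gs P j x (- w) - gs P j (xsv zs j) 0) \<le> 0"
    and dissip_strict: "\<lbrakk>j \<in> buses P; x \<in> Ws P j; dist x (xsv zs j) \<le> R; \<bar>w\<bar> \<le> R; w \<noteq> 0\<rbrakk>
       \<Longrightarrow> blinfun_apply (V' j x) (fs P j x (- w)) + w * (gs P j x (- w) - gs P j (xsv zs j) 0) < 0"
begin

lemma finite_buses: "finite (buses P)" by (simp add: buses_def)

lemma edges_sub: "edges P \<subseteq> buses P \<times> buses P"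
  using net by (simp add: network_ok_def)

lemma finite_edges: "finite (edges P)"
  using edges_sub finite_buses by (meson finite_SigmaI finite_subset)

lemma M_pos: "j \<in> buses P \<Longrightarrow> Mc P j > 0" and B_pos: "e \<in> edges P \<Longrightarrow> Bc P e > 0"
  using net by (auto simp: network_ok_def)

lemma Ws_subspace: "j \<in> buses P \<Longrightarrow> subspace (Ws P j)"
  using net by (simp add: network_ok_def)

lemma Ws_closed: "j \<in> buses P \<Longrightarrow> closed (Ws P j)"
  using Ws_subspace closed_subspace by blast

definition lyap :: "'a hstate \<Rightarrow> real" where
  "lyap z = (\<Sum>e\<in>edges P. Bc P e * edge_energy (eta zs e) (eta z e))
     + (\<Sum>j\<in>buses P. Mc P j * (omg z j)\<^sup>2 / 2)
     + (\<Sum>j\<in>buses P. V j (xsv z j) - V j (xsv zs j))"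

text \<open>The share of bus \<open>j\<close> in the derivative of \<open>lyap\<close>, after the
  power exchanged along the edges has cancelled.\<close>

definition rate :: "nat \<Rightarrow> 'a \<Rightarrow> real \<Rightarrow> real" where
  "rate j x w = blinfun_apply (V' j x) (fs P j x (- w)) + w * (gs P j x (- w) - gs P j (xsv zs j) 0)"

text \<open>A closed box, with \<open>inside\<close> its open counterpart. A box fits the separable
  form of \<open>lyap\<close>: at a boundary point at least one single coordinate is at distance
  \<open>R\<close>.\<close>

definition near :: "'a hstate \<Rightarrow> bool" where
  "near z \<longleftrightarrow> (\<forall>e\<in>edges P. \<bar>eta z e - eta zs e\<bar> \<le> R) \<and>
     (\<forall>j\<in>buses P. xsv z j \<in> Ws P j \<and> \<bar>omg z j\<bar> \<le> R \<and> dist (xsv z j) (xsv zs j) \<le> R)"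

definition inside :: "'a hstate \<Rightarrow> bool" where
  "inside z \<longleftrightarrow> (\<forall>e\<in>edges P. \<bar>eta z e - eta zs e\<bar> < R) \<and>
     (\<forall>j\<in>buses P. \<bar>omg z j\<bar> < R \<and> dist (xsv z j) (xsv zs j) < R)"

lemma rate_nonpos: "\<lbrakk>near z; j \<in> buses P\<rbrakk> \<Longrightarrow> rate j (xsv z j) (omg z j) \<le> 0"
  unfolding rate_def near_def using dissip by blast

text \<open>What the power flows feed into the kinetic energies is taken from the edge potentials,
  so these terms cancel, and \<sigma> = 0 removes the loads. Only terms local to each bus are
  left.\<close>

lemma lyap_has_derivative:
  assumes fl: "flows_on P z I" and t: "t \<in> I" and sig0: "\<And>j. j \<in> buses P \<Longrightarrow> sig (z t) j = 0"
  shows "((\<lambda>s. lyap (z s)) has_real_derivative (\<Sum>j\<in>buses P. rate j (xsv (z t) j) (omg (z t) j)))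
    (at t within I)"
proof -
  let ?F = "at t within I"
  \<comment> \<open>The edge flow relative to equilibrium; \<open>balance\<close> permits
    subtracting the equilibrium values at every bus.\<close>
  define D where "D e = Bc P e * (sin (eta (z t) e) - sin (eta zs e))" for e
  let ?w = "omg (z t)"
  have d1: "((\<lambda>s. Bc P e * edge_energy (eta zs e) (eta (z s) e)) has_real_derivative
      D e * (?w (fst e) - ?w (snd e))) ?F" if e: "e \<in> edges P" for e
  proof -
    have "((\<lambda>s. eta (z s) e) has_real_derivative (?w (fst e) - ?w (snd e))) ?F"
      using fl t e unfolding flows_on_def flow_eta_def by auto
    then show ?thesis
      unfolding edge_energy_def D_def by (auto intro!: derivative_eq_intros simp: algebra_simps)
  qed
  have d2: "((\<lambda>s. Mc P j * (omg (z s) j)\<^sup>2 / 2) has_real_derivative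
      Mc P j * ?w j * flow_om P (z t) j) ?F" if j: "j \<in> buses P" for j
  proof -
    have "((\<lambda>s. omg (z s) j) has_real_derivative flow_om P (z t) j) ?F"
      using fl t j unfolding flows_on_def by auto
    then show ?thesis by (auto intro!: derivative_eq_intros)
  qed
  have d3: "((\<lambda>s. V j (xsv (z s) j) - V j (xsv zs j)) has_real_derivative
      blinfun_apply (V' j (xsv (z t) j)) (fs P j (xsv (z t) j) (- ?w j))) ?F" if j: "j \<in> buses P" for j
  proof -
    have x: "((\<lambda>s. xsv (z s) j) has_vector_derivative fs P j (xsv (z t) j) (- ?w j)) ?F"
      using fl t j unfolding flows_on_def flow_xs_def by auto
    have "((\<lambda>s. V j (xsv (z s) j)) has_vector_derivative
        blinfun_apply (V' j (xsv (z t) j)) (fs P j (xsv (z t) j) (- ?w j))) ?F"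
      using vector_derivative_diff_chain_within[OF x has_derivative_at_withinI[OF V_deriv[OF j]]]
      by (simp add: o_def)
    then show ?thesis
      unfolding has_real_derivative_iff_has_vector_derivative
      by (auto intro!: derivative_eq_intros)
  qed
  have om: "Mc P j * ?w j * flow_om P (z t) j = ?w j * (gs P j (xsv (z t) j) (- ?w j) - gs P j (xsv zs j) 0)
      - ?w j * (\<Sum>k\<in>{k. (j, k) \<in> edges P}. D (j, k)) + ?w j * (\<Sum>i\<in>{i. (i, j) \<in> edges P}. D (i, j))"
    if j: "j \<in> buses P" for j
  proof -
    have "Mc P j * flow_om P (z t) j = - pLc P j + gs P j (xsv (z t) j) (- ?w j)
       - (\<Sum>k\<in>{k. (j, k) \<in> edges P}. pflow P (z t) (j, k))
       + (\<Sum>i\<in>{i. (i, j) \<in> edges P}. pflow P (z t) (i, j))"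
      using j M_pos[OF j] sig0[OF j] unfolding flow_om_def by simp
    also have "\<dots> = gs P j (xsv (z t) j) (- ?w j) - gs P j (xsv zs j) 0
       - (\<Sum>k\<in>{k. (j, k) \<in> edges P}. D (j, k)) + (\<Sum>i\<in>{i. (i, j) \<in> edges P}. D (i, j))"
      using balance[OF j] by (simp add: D_def pflow_def right_diff_distrib sum_subtractf)
    finally have "?w j * (Mc P j * flow_om P (z t) j) = ?w j * (gs P j (xsv (z t) j) (- ?w j) - gs P j (xsv zs j) 0
       - (\<Sum>k\<in>{k. (j, k) \<in> edges P}. D (j, k)) + (\<Sum>i\<in>{i. (i, j) \<in> edges P}. D (i, j)))"
      by simp
    then show ?thesis by (simp add: algebra_simps)
  qed
  have om_sum: "(\<Sum>j\<in>buses P. Mc P j * ?w j * flow_om P (z t) j)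
      = (\<Sum>j\<in>buses P. ?w j * (gs P j (xsv (z t) j) (- ?w j) - gs P j (xsv zs j) 0))
        - (\<Sum>e\<in>edges P. ?w (fst e) * D e) + (\<Sum>e\<in>edges P. ?w (snd e) * D e)"
    unfolding sum_over_edges_fst[OF finite_buses edges_sub, of ?w D, symmetric]
      sum_over_edges_snd[OF finite_buses edges_sub, of ?w D, symmetric]
      sum_subtractf[symmetric] sum.distrib[symmetric]
    by (rule sum.cong[OF refl om])
  have total: "(\<Sum>e\<in>edges P. D e * (?w (fst e) - ?w (snd e))) + (\<Sum>j\<in>buses P. Mc P j * ?w j * flow_om P (z t) j)
      + (\<Sum>j\<in>buses P. blinfun_apply (V' j (xsv (z t) j)) (fs P j (xsv (z t) j) (- ?w j)))
      = (\<Sum>j\<in>buses P. rate j (xsv (z t) j) (?w j))"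
    unfolding om_sum by (simp add: rate_def sum.distrib sum_subtractf algebra_simps)
  show ?thesis
    unfolding lyap_def total[symmetric] by (intro DERIV_add DERIV_sum d1 d2 d3)
qed

end

section \<open>Tools from calculus and compactness\<close>

lemma nonpos_derivative_le:
  fixes f :: "real \<Rightarrow> real"
  assumes st: "s \<le> t" "{s..t} \<subseteq> I"
    and der: "\<And>x. x \<in> {s..t} \<Longrightarrow> (f has_real_derivative g x) (at x within I)"
    and le: "\<And>x. x \<in> {s..t} \<Longrightarrow> g x \<le> 0"
  shows "f t \<le> f s"
proof (cases "s = t")
  case False
  have "\<exists>x\<in>{s<..<t}. f t - f s = (\<lambda>y. g x * y) (t - s)"
  proof (rule mvt_simple)
    fix x assume x: "s \<le> x" "x \<le> t"
    then have "(f has_real_derivative g x) (at x within {s..t})"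
      using has_field_derivative_subset[OF der st(2)] by auto
    then show "(f has_derivative (\<lambda>y. g x * y)) (at x within {s..t})"
      unfolding has_field_derivative_def by simp
  qed (use st False in auto)
  then obtain x where x: "x \<in> {s<..<t}" "f t - f s = g x * (t - s)" by auto
  have "g x * (t - s) \<le> 0"
    using le[of x] x(1) st(1) by (intro mult_nonpos_nonneg) auto
  then show ?thesis using x(2) by simp
qed simp

lemma continuous_on_le_at_right_end:
  fixes h :: "real \<Rightarrow> real"
  assumes "continuous_on {a..b} h" "a < b" "\<And>s. s \<in> {a..<b} \<Longrightarrow> h s \<le> c"
  shows "h b \<le> c"
  using continuous_le_on_closure[of "{a..<b}" h b c] assms by simp

lemma continuous_on_lipschitz_pair:
  assumes lip: "L-lipschitz_on (W \<times> UNIV) (\<lambda>(x, u). f x u)"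
    and x: "continuous_on S x" and u: "continuous_on S u" and xW: "\<And>t. t \<in> S \<Longrightarrow> x t \<in> W"
  shows "continuous_on S (\<lambda>t. f (x t) (u t))"
proof -
  have "continuous_on S ((\<lambda>(x, u). f x u) \<circ> (\<lambda>t. (x t, u t)))"
    by (rule continuous_on_compose[OF continuous_on_Pair[OF x u]],
        rule continuous_on_subset[OF lipschitz_on_continuous_on[OF lip]]) (use xW in auto)
  then show ?thesis by (simp add: o_def)
qed

lemma finite_common_lower_bound:
  fixes h :: "'i \<Rightarrow> 'x \<Rightarrow> real"
  assumes fin: "finite I" and ex: "\<And>i. i \<in> I \<Longrightarrow> \<exists>c>0. \<forall>x. Q i x \<longrightarrow> c \<le> h i x"
  shows "\<exists>c>0. \<forall>i\<in>I. \<forall>x. Q i x \<longrightarrow> c \<le> h i x"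
proof -
  have "\<forall>i\<in>I. \<exists>c. c > 0 \<and> (\<forall>x. Q i x \<longrightarrow> c \<le> h i x)" using ex by simp
  from bchoice[OF this] obtain c where c: "\<forall>i\<in>I. c i > 0 \<and> (\<forall>x. Q i x \<longrightarrow> c i \<le> h i x)" ..
  \<comment> \<open>The 1 supplies a value when \<open>I\<close> is empty.\<close>
  define d where "d = Min (insert 1 (c ` I))"
  have "d > 0" using fin c by (auto simp: d_def)
  moreover have "d \<le> h i x" if "i \<in> I" "Q i x" for i x
  proof -
    have "d \<le> c i" using fin that by (auto simp: d_def)
    also have "c i \<le> h i x" using c that by blast
    finally show ?thesis .
  qed
  ultimately show ?thesis by (intro exI[of _ d]) simp
qed

section \<open>Energy barrier on the boundary of the box, and confinement\<close>

context passive_network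
begin

lemma fs_lip: "j \<in> buses P \<Longrightarrow> \<exists>L. L-lipschitz_on (Ws P j \<times> UNIV) (\<lambda>(x, u). fs P j x u)"
  and gs_lip: "j \<in> buses P \<Longrightarrow> \<exists>L. L-lipschitz_on (Ws P j \<times> UNIV) (\<lambda>(x, u). gs P j x u)"
  using net by (simp_all add: network_ok_def)

lemma inside_imp_near: "\<lbrakk>inside z; \<And>j. j \<in> buses P \<Longrightarrow> xsv z j \<in> Ws P j\<rbrakk> \<Longrightarrow> near z"
  unfolding inside_def near_def by (auto intro: less_imp_le)

lemma edge_term_nonneg:
  assumes "e \<in> edges P" "\<bar>x - eta zs e\<bar> \<le> R"
  shows "0 \<le> Bc P e * edge_energy (eta zs e) x"
proof (cases "x = eta zs e")
  case False
  have "\<bar>x\<bar> < pi / 2" "\<bar>eta zs e\<bar> < pi / 2" using R_eta[OF assms(1)] R_pos assms(2) by linarith+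
  then show ?thesis using edge_energy_pos[of "eta zs e" x] False B_pos[OF assms(1)] by simp
qed (simp add: edge_energy_def)

lemma storage_term_nonneg:
  assumes "near z" "j \<in> buses P"
  shows "0 \<le> V j (xsv z j) - V j (xsv zs j)"
  using V_min[OF assms(2), of "xsv z j"] assms unfolding near_def by force

lemma kinetic_term_nonneg: "j \<in> buses P \<Longrightarrow> 0 \<le> Mc P j * (omg z j)\<^sup>2 / 2"
  using M_pos[of j] by simp

text \<open>No summand is negative in the box, so each one is dominated by the sum. A bound in one
  coordinate thus becomes a bound on \<open>lyap\<close>.\<close>

lemma lyap_ge_terms:
  assumes "near z"
  shows "e \<in> edges P \<Longrightarrow> Bc P e * edge_energy (eta zs e) (eta z e) \<le> lyap z"
    and "j \<in> buses P \<Longrightarrow> Mc P j * (omg z j)\<^sup>2 / 2 \<le> lyap z"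
    and "j \<in> buses P \<Longrightarrow> V j (xsv z j) - V j (xsv zs j) \<le> lyap z"
    and "0 \<le> lyap z"
proof -
  let ?A = "\<Sum>e\<in>edges P. Bc P e * edge_energy (eta zs e) (eta z e)"
  let ?B = "\<Sum>j\<in>buses P. Mc P j * (omg z j)\<^sup>2 / 2"
  let ?C = "\<Sum>j\<in>buses P. V j (xsv z j) - V j (xsv zs j)"
  have e0: "0 \<le> Bc P e * edge_energy (eta zs e) (eta z e)" if "e \<in> edges P" for e
    using edge_term_nonneg[OF that] assms that by (simp add: near_def)
  have A: "?A \<ge> 0" by (intro sum_nonneg e0)
  have B: "?B \<ge> 0" by (intro sum_nonneg kinetic_term_nonneg)
  have C: "?C \<ge> 0" by (intro sum_nonneg storage_term_nonneg assms)
  show "0 \<le> lyap z" using A B C by (simp add: lyap_def)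
  show "Bc P e * edge_energy (eta zs e) (eta z e) \<le> lyap z" if "e \<in> edges P"
    using member_le_sum[OF that, of "\<lambda>e. Bc P e * edge_energy (eta zs e) (eta z e)"] e0
      finite_edges B C unfolding lyap_def by simp
  show "Mc P j * (omg z j)\<^sup>2 / 2 \<le> lyap z" if "j \<in> buses P"
    using member_le_sum[OF that, of "\<lambda>j. Mc P j * (omg z j)\<^sup>2 / 2"] kinetic_term_nonneg[of _ z]
      finite_buses A C unfolding lyap_def by simp
  show "V j (xsv z j) - V j (xsv zs j) \<le> lyap z" if "j \<in> buses P"
    using member_le_sum[OF that, of "\<lambda>j. V j (xsv z j) - V j (xsv zs j)"] storage_term_nonneg[OF assms]
      finite_buses A B unfolding lyap_def by simp
qed

lemma edge_boundary_bound:
  assumes e: "e \<in> edges P"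
  shows "\<exists>c>0. \<forall>x. \<bar>x - eta zs e\<bar> = R \<longrightarrow> c \<le> Bc P e * edge_energy (eta zs e) x"
proof -
  let ?a = "eta zs e"
  have bd: "\<bar>?a\<bar> < pi / 2" "\<bar>?a + R\<bar> < pi / 2" "\<bar>?a - R\<bar> < pi / 2"
    using R_eta[OF e] R_pos by linarith+
  define c where "c = Bc P e * min (edge_energy ?a (?a + R)) (edge_energy ?a (?a - R))"
  have "c > 0"
    using edge_energy_pos[OF bd(1,2)] edge_energy_pos[OF bd(1,3)] R_pos B_pos[OF e] by (simp add: c_def)
  moreover have "c \<le> Bc P e * edge_energy ?a x" if "\<bar>x - ?a\<bar> = R" for x
  proof -
    have "x = ?a + R \<or> x = ?a - R" using that by linarith
    then have "min (edge_energy ?a (?a + R)) (edge_energy ?a (?a - R)) \<le> edge_energy ?a x" by auto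
    then show ?thesis using B_pos[OF e] unfolding c_def by simp
  qed
  ultimately show ?thesis by (intro exI[of _ c]) simp
qed

text \<open>The sphere within the subspace is compact, so the minimum is attained, and strict
  minimality makes the gap positive. For a trivial subspace the sphere is empty and any constant
  works.\<close>

lemma storage_boundary_bound:
  assumes j: "j \<in> buses P"
  shows "\<exists>c>0. \<forall>x. x \<in> Ws P j \<and> dist x (xsv zs j) = R \<longrightarrow> c \<le> V j x - V j (xsv zs j)"
proof -
  let ?S = "{x. x \<in> Ws P j \<and> dist x (xsv zs j) = R}"
  have "?S = Ws P j \<inter> sphere (xsv zs j) R" by (auto simp: dist_commute)
  then have S: "compact ?S" using Ws_closed[OF j] by (simp add: closed_Int_compact)
  have cont: "continuous_on ?S (V j)"
    by (intro continuous_at_imp_continuous_on ballI has_derivative_continuous[OF V_deriv[OF j]])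
  show ?thesis
  proof (cases "?S = {}")
    case True
    then show ?thesis by (intro exI[of _ 1]) auto
  next
    case False
    obtain x where x: "x \<in> ?S" "\<forall>y\<in>?S. V j x \<le> V j y"
      using continuous_attains_inf[OF S False cont] by blast
    have "V j (xsv zs j) < V j x"
      using x(1) R_pos by (intro V_min[OF j]) auto
    then show ?thesis
      using x(2) by (intro exI[of _ "V j x - V j (xsv zs j)"]) auto
  qed
qed

text \<open>Some coordinate of a boundary point is exactly at distance \<open>R\<close>, and its own
  summand is already at least a positive constant.\<close>

lemma lyap_boundary_bound: "\<exists>c>0. \<forall>z. near z \<and> \<not> inside z \<longrightarrow> c \<le> lyap z"
proof -
  from finite_common_lower_bound[OF finite_edges edge_boundary_bound]
  obtain c1 where c1: "c1 > 0 \<and> (\<forall>e\<in>edges P. \<forall>x. \<bar>x - eta zs e\<bar> = R \<longrightarrow>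
    c1 \<le> Bc P e * edge_energy (eta zs e) x)" ..
  have kin: "\<exists>c>0. \<forall>w. \<bar>w\<bar> = R \<longrightarrow> c \<le> Mc P j * w\<^sup>2 / 2" if "j \<in> buses P" for j
  proof (intro exI[of _ "Mc P j * R\<^sup>2 / 2"] conjI allI impI)
    show "Mc P j * R\<^sup>2 / 2 > 0" using M_pos[OF that] R_pos by simp
    show "Mc P j * R\<^sup>2 / 2 \<le> Mc P j * w\<^sup>2 / 2" if "\<bar>w\<bar> = R" for w
      unfolding that[symmetric] by simp
  qed
  from finite_common_lower_bound[OF finite_buses kin]
  obtain c2 where c2: "c2 > 0 \<and> (\<forall>j\<in>buses P. \<forall>w. \<bar>w\<bar> = R \<longrightarrow> c2 \<le> Mc P j * w\<^sup>2 / 2)" ..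
  from finite_common_lower_bound[OF finite_buses storage_boundary_bound]
  obtain c3 where c3: "c3 > 0 \<and> (\<forall>j\<in>buses P. \<forall>x. x \<in> Ws P j \<and> dist x (xsv zs j) = R \<longrightarrow>
    c3 \<le> V j x - V j (xsv zs j))" ..
  have "min c1 (min c2 c3) \<le> lyap z" if z: "near z" and ni: "\<not> inside z" for z
  proof -
    from ni consider (1) e where "e \<in> edges P" "\<not> \<bar>eta z e - eta zs e\<bar> < R"
      | (2) j where "j \<in> buses P" "\<not> \<bar>omg z j\<bar> < R"
      | (3) j where "j \<in> buses P" "\<not> dist (xsv z j) (xsv zs j) < R"
      unfolding inside_def by blast
    then show ?thesis
    proof cases
      case 1
      then have "\<bar>eta z e - eta zs e\<bar> = R" using z by (force simp: near_def)
      then have "c1 \<le> Bc P e * edge_energy (eta zs e) (eta z e)" using c1 1(1) by blast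
      then show ?thesis using lyap_ge_terms(1)[OF z 1(1)] by linarith
    next
      case 2
      then have "\<bar>omg z j\<bar> = R" using z by (force simp: near_def)
      then have "c2 \<le> Mc P j * (omg z j)\<^sup>2 / 2" using c2 2(1) by blast
      then show ?thesis using lyap_ge_terms(2)[OF z 2(1)] by linarith
    next
      case 3
      then have "xsv z j \<in> Ws P j \<and> dist (xsv z j) (xsv zs j) = R" using z by (force simp: near_def)
      then have "c3 \<le> V j (xsv z j) - V j (xsv zs j)" using c3 3(1) by blast
      then show ?thesis using lyap_ge_terms(3)[OF z 3(1)] by linarith
    qed
  qed
  then show ?thesis using c1 c2 c3 by (intro exI[of _ "min c1 (min c2 c3)"]) auto
qed

lemma lyap_nonincreasing:
  assumes "flows_on P z I" "s \<le> t" "{s..t} \<subseteq> I" "\<And>x. x \<in> {s..t} \<Longrightarrow> near (z x)"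
    and "\<And>x j. \<lbrakk>x \<in> {s..t}; j \<in> buses P\<rbrakk> \<Longrightarrow> sig (z x) j = 0"
  shows "lyap (z t) \<le> lyap (z s)"
proof (rule nonpos_derivative_le[OF assms(2,3)])
  fix x assume x: "x \<in> {s..t}"
  show "((\<lambda>s. lyap (z s)) has_real_derivative (\<Sum>j\<in>buses P. rate j (xsv (z x) j) (omg (z x) j))) (at x within I)"
    by (rule lyap_has_derivative[OF assms(1)]) (use x assms in auto)
  show "(\<Sum>j\<in>buses P. rate j (xsv (z x) j) (omg (z x) j)) \<le> 0"
    by (intro sum_nonpos rate_nonpos assms x)
qed

text \<open>At the first exit time the state is still in the closed box by continuity, and there the
  barrier \<open>c\<close> contradicts the decrease of \<open>lyap\<close> from a value below
  \<open>c\<close>. The premise \<open>flow\<close> is conditional on earlier confinement because a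
  hybrid solution is known to obey the equation with \<sigma> = 0 only while it is in the
  box.\<close>

lemma trapped:
  assumes c: "\<forall>z. near z \<and> \<not> inside z \<longrightarrow> c \<le> lyap z"
    and cont_eta: "\<And>e. e \<in> edges P \<Longrightarrow> continuous_on {0..b} (\<lambda>t. eta (z t) e)"
    and cont_om: "\<And>j. j \<in> buses P \<Longrightarrow> continuous_on {0..b} (\<lambda>t. omg (z t) j)"
    and cont_xs: "\<And>j. j \<in> buses P \<Longrightarrow> continuous_on {0..b} (\<lambda>t. xsv (z t) j)"
    and W: "\<And>t j. \<lbrakk>t \<in> {0..b}; j \<in> buses P\<rbrakk> \<Longrightarrow> xsv (z t) j \<in> Ws P j"
    and sig0: "\<And>t j. \<lbrakk>t \<in> {0..b}; j \<in> buses P\<rbrakk> \<Longrightarrow> sig (z t) j = 0"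
    and z0: "inside (z 0)" "lyap (z 0) < c"
    and flow: "\<And>\<tau>. \<lbrakk>0 < \<tau>; \<tau> \<le> b; \<And>s. s \<in> {0..<\<tau>} \<Longrightarrow> inside (z s)\<rbrakk> \<Longrightarrow> flows_on P z {0..\<tau>}"
    and t: "t \<in> {0..b}"
  shows "inside (z t)"
proof (rule ccontr)
  assume nt: "\<not> inside (z t)"
  \<comment> \<open>The exit times form a finite union of closed sets within \<open>{0..b}\<close>,
    hence a compact set, so a first one exists.\<close>
  define A where "A = {s \<in> {0..b}. \<not> inside (z s)}"
  have "A = (\<Union>e\<in>edges P. {s \<in> {0..b}. R \<le> \<bar>eta (z s) e - eta zs e\<bar>}) \<union>
      (\<Union>j\<in>buses P. {s \<in> {0..b}. R \<le> \<bar>omg (z s) j\<bar>}) \<union>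
      (\<Union>j\<in>buses P. {s \<in> {0..b}. R \<le> dist (xsv (z s) j) (xsv zs j)})"
    unfolding A_def inside_def by (auto simp: not_less)
  also have "closed \<dots>"
  proof (intro closed_Un closed_UN finite_edges finite_buses ballI)
    show "closed {s \<in> {0..b}. R \<le> \<bar>eta (z s) e - eta zs e\<bar>}" if "e \<in> edges P" for e
      by (intro continuous_on_closed_Collect_le continuous_on_const continuous_on_rabs
          continuous_on_diff cont_eta that closed_atLeastAtMost)
    show "closed {s \<in> {0..b}. R \<le> \<bar>omg (z s) j\<bar>}" if "j \<in> buses P" for j
      by (intro continuous_on_closed_Collect_le continuous_on_const continuous_on_rabs
          cont_om that closed_atLeastAtMost)
    show "closed {s \<in> {0..b}. R \<le> dist (xsv (z s) j) (xsv zs j)}" if "j \<in> buses P" for j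
      by (intro continuous_on_closed_Collect_le continuous_on_const continuous_on_dist
          cont_xs that closed_atLeastAtMost)
  qed
  finally have "closed A" .
  moreover have "bounded A" by (rule bounded_subset[of "{0..b}"]) (auto simp: A_def)
  ultimately have "compact A" by (simp add: compact_eq_bounded_closed)
  have "A \<noteq> {}" using nt t by (auto simp: A_def)
  from compact_attains_inf[OF \<open>compact A\<close> this] obtain \<tau> where \<tau>: "\<tau> \<in> A" "\<forall>s\<in>A. \<tau> \<le> s" ..
  have \<tau>b: "0 \<le> \<tau>" "\<tau> \<le> b" and ni: "\<not> inside (z \<tau>)"
    using \<tau>(1) by (simp_all add: A_def)
  have "\<tau> \<noteq> 0" using ni z0 by auto
  then have \<tau>0: "0 < \<tau>" using \<tau>b by simp
  have before: "inside (z s)" if "s \<in> {0..<\<tau>}" for s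
  proof (rule ccontr)
    assume "\<not> inside (z s)"
    then have "s \<in> A" using that \<tau>b by (simp add: A_def)
    then have "\<tau> \<le> s" using \<tau>(2) by blast
    then show False using that by simp
  qed
  have fl: "flows_on P z {0..\<tau>}" by (rule flow[OF \<tau>0 \<tau>b(2) before])
  have at_end: "h \<tau> \<le> R" if "continuous_on {0..b} h" "\<And>s. s \<in> {0..<\<tau>} \<Longrightarrow> h s < R" for h :: "real \<Rightarrow> real"
  proof (rule continuous_on_le_at_right_end[OF continuous_on_subset[OF that(1)] \<tau>0])
    show "h s \<le> R" if "s \<in> {0..<\<tau>}" for s
      by (rule less_imp_le[OF \<open>\<And>s. s \<in> {0..<\<tau>} \<Longrightarrow> h s < R\<close>[OF that]])
  qed (use \<tau>b in auto)
  have near_\<tau>: "near (z \<tau>)"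
    unfolding near_def
  proof (intro conjI ballI)
    show "\<bar>eta (z \<tau>) e - eta zs e\<bar> \<le> R" if e: "e \<in> edges P" for e
    proof (rule at_end[of "\<lambda>t. \<bar>eta (z t) e - eta zs e\<bar>"])
      show "continuous_on {0..b} (\<lambda>t. \<bar>eta (z t) e - eta zs e\<bar>)"
        by (intro continuous_on_rabs continuous_on_diff cont_eta e continuous_on_const)
    qed (use before e in \<open>simp add: inside_def\<close>)
    show "\<bar>omg (z \<tau>) j\<bar> \<le> R" if j: "j \<in> buses P" for j
    proof (rule at_end[of "\<lambda>t. \<bar>omg (z t) j\<bar>"])
      show "continuous_on {0..b} (\<lambda>t. \<bar>omg (z t) j\<bar>)"
        by (intro continuous_on_rabs cont_om j)
    qed (use before j in \<open>simp add: inside_def\<close>)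
    show "dist (xsv (z \<tau>) j) (xsv zs j) \<le> R" if j: "j \<in> buses P" for j
    proof (rule at_end[of "\<lambda>t. dist (xsv (z t) j) (xsv zs j)"])
      show "continuous_on {0..b} (\<lambda>t. dist (xsv (z t) j) (xsv zs j))"
        by (intro continuous_on_dist cont_xs j continuous_on_const)
    qed (use before j in \<open>simp add: inside_def\<close>)
    show "xsv (z \<tau>) j \<in> Ws P j" if "j \<in> buses P" for j
      using W that \<tau>b by auto
  qed
  have "near (z s)" if "s \<in> {0..\<tau>}" for s
  proof (cases "s = \<tau>")
    case False
    then show ?thesis using that \<tau>b W by (intro inside_imp_near before) auto
  qed (use near_\<tau> in simp)
  then have "lyap (z \<tau>) \<le> lyap (z 0)"
    using \<tau>b sig0 by (intro lyap_nonincreasing[OF fl]) auto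
  moreover have "c \<le> lyap (z \<tau>)" using c near_\<tau> ni by blast
  ultimately show False using z0 by simp
qed

end

section \<open>Hybrid solutions on the first time interval\<close>

text \<open>Membership in \<open>C\<close>, and with it \<open>\<sigma> = 0\<close>, is available at interior times only. Resetting the
  discrete state lets the differential equation be stated up to the endpoints.\<close>

definition frozen :: "(real \<times> nat \<Rightarrow> 'a hstate) \<Rightarrow> real \<Rightarrow> 'a hstate" where
  "frozen z t = (fst (z (t, 0)), \<lambda>_. 0)"

lemma frozen_simps [simp]:
  "eta (frozen z t) = eta (z (t, 0))" "omg (frozen z t) = omg (z (t, 0))"
  "xsv (frozen z t) = xsv (z (t, 0))" "sig (frozen z t) j = 0" "fst (frozen z t) = fst (z (t, 0))"
  by (simp_all add: frozen_def eta_def omg_def xsv_def sig_def)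

lemma abs_cont_on_slice:
  assumes "loc_abs_cont_on T h" "{a..b} \<subseteq> T"
  shows "abs_cont_on {a..b} h"
  using assms unfolding loc_abs_cont_on_def by simp

lemma Dset_subset_Cset: "Dset P \<subseteq> Cset P"
  by (auto simp: Dset_def)

text \<open>A compact interval of the first slice is singled out because local absolute continuity
  is a statement about such intervals.\<close>

locale solution_slice =
  fixes P :: "'a::euclidean_space net" and z :: "real \<times> nat \<Rightarrow> 'a hstate" and K :: "(real \<times> nat) set"
    and b :: real
  assumes sol: "hsolution P z K" and net_ok: "network_ok P" and slice: "{0..b} \<subseteq> {t. (t, 0) \<in> K}"
begin

abbreviation "T \<equiv> {t. (t, 0::nat) \<in> K}"

lemma slice_props:
  "\<And>e. e \<in> edges P \<Longrightarrow> loc_abs_cont_on T (\<lambda>t. eta (z (t, 0)) e)"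
  "\<And>j. j \<in> buses P \<Longrightarrow> loc_abs_cont_on T (\<lambda>t. omg (z (t, 0)) j)"
  "\<And>j. j \<in> buses P \<Longrightarrow> loc_abs_cont_on T (\<lambda>t. xsv (z (t, 0)) j)"
  "\<And>t. t \<in> interior T \<Longrightarrow> z (t, 0) \<in> Cset P"
  "z (0, 0) \<in> Cset P"
proof -
  note s = sol[unfolded hsolution_def Let_def, THEN conjunct2, THEN conjunct2]
  show "z (0, 0) \<in> Cset P" using s[THEN conjunct1] Dset_subset_Cset by blast
  note s0 = s[THEN conjunct2, THEN conjunct1, THEN spec, of 0]
  show "loc_abs_cont_on T (\<lambda>t. eta (z (t, 0)) e)" if "e \<in> edges P" for e
    using s0 that by simp
  show "loc_abs_cont_on T (\<lambda>t. omg (z (t, 0)) j)" if "j \<in> buses P" for j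
    using s0 that by simp
  show "loc_abs_cont_on T (\<lambda>t. xsv (z (t, 0)) j)" if "j \<in> buses P" for j
    using s0 that by simp
  show "z (t, 0) \<in> Cset P" if "t \<in> interior T" for t
  proof -
    have "interior T \<noteq> {}" using that by auto
    then show ?thesis using s0 that by simp
  qed
qed

definition ode_at :: "real \<Rightarrow> bool" where
  "ode_at t \<longleftrightarrow>
     (\<forall>e\<in>edges P. ((\<lambda>s. eta (z (s, 0)) e) has_real_derivative flow_eta P (z (t, 0)) e) (at t within T)) \<and>
     (\<forall>j\<in>buses P. ((\<lambda>s. omg (z (s, 0)) j) has_real_derivative flow_om P (z (t, 0)) j) (at t within T) \<and>
        ((\<lambda>s. xsv (z (s, 0)) j) has_vector_derivative flow_xs P (z (t, 0)) j) (at t within T) \<and>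
        ((\<lambda>s. real_of_int (sig (z (s, 0)) j)) has_real_derivative 0) (at t within T))"

lemma slice_ode:
  assumes "interior T \<noteq> {}"
  shows "\<exists>N. negligible N \<and> {t. \<not> (t \<in> T \<longrightarrow> ode_at t)} \<subseteq> N"
proof -
  note s = sol[unfolded hsolution_def Let_def, THEN conjunct2, THEN conjunct2]
  note s0 = s[THEN conjunct2, THEN conjunct1, THEN spec, of 0]
  have "AE t in lebesgue. t \<in> T \<longrightarrow> ode_at t"
    unfolding ode_at_def
    using s0[THEN conjunct2, THEN conjunct2, THEN mp, OF assms, THEN conjunct2] .
  then show ?thesis unfolding eventually_ae_filter_negligible .
qed

lemma slice_cont:
  "\<And>e. e \<in> edges P \<Longrightarrow> continuous_on {0..b} (\<lambda>t. eta (z (t, 0)) e)"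
  "\<And>j. j \<in> buses P \<Longrightarrow> continuous_on {0..b} (\<lambda>t. omg (z (t, 0)) j)"
  "\<And>j. j \<in> buses P \<Longrightarrow> continuous_on {0..b} (\<lambda>t. xsv (z (t, 0)) j)"
  by (rule continuous_on_abs_cont_on, rule abs_cont_on_slice[OF _ slice], erule slice_props)+

lemma interior_slice: "{0<..<b} \<subseteq> interior T"
  by (rule interior_maximal) (use slice in \<open>auto simp: subset_eq\<close>)

text \<open>At interior times this is part of membership in \<open>Cset P\<close>, at time 0 it is
  the initial condition, and at the right end it follows by continuity because subspaces are
  closed.\<close>

lemma slice_Ws:
  assumes t: "t \<in> {0..b}" and j: "j \<in> buses P"
  shows "xsv (z (t, 0)) j \<in> Ws P j"
proof -
  have C: "xsv (z (t, 0)) j \<in> Ws P j" if "z (t, 0) \<in> Cset P" for t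
    using that j by (cases "fst (z (t, 0))") (auto simp: Cset_def state_space_def xsv_def)
  show ?thesis
  proof (cases "0 < t \<and> t < b")
    case True
    then show ?thesis using interior_slice by (intro C slice_props(4)) auto
  next
    case False
    consider "t = 0" | "t = b" "0 < b" using False t by fastforce
    then show ?thesis
    proof cases
      case 1
      then show ?thesis using C slice_props(5) by simp
    next
      case 2
      have cl: "closed (Ws P j)" using net_ok j by (simp add: network_ok_def closed_subspace)
      have "(\<lambda>t. xsv (z (t, 0)) j) ` closure {0<..<b} \<subseteq> Ws P j"
      proof (rule image_closure_subset[OF _ cl])
        show "continuous_on (closure {0<..<b}) (\<lambda>t. xsv (z (t, 0)) j)"
          using slice_cont(3)[OF j] 2 by simp
        show "(\<lambda>t. xsv (z (t, 0)) j) ` {0<..<b} \<subseteq> Ws P j"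
          using interior_slice slice_props(4) C by auto
      qed
      then show ?thesis using 2 by auto
    qed
  qed
qed

lemma slice_subslice: "c \<le> b \<Longrightarrow> solution_slice P z K c"
  using sol net_ok slice by unfold_locales (auto simp: subset_eq)

end

lemma flow_om_sig0:
  assumes "sig z j = 0" "sig w j = 0" "eta z = eta w" "omg z = omg w" "xsv z = xsv w"
  shows "flow_om P z j = flow_om P w j"
  using assms by (simp add: flow_om_def pflow_def)

text \<open>Holding \<sigma> at 0 removes the only term that could be discontinuous; the others are
  Lipschitz or trigonometric in continuous arguments.\<close>

lemma continuous_on_frozen_flow:
  fixes P :: "'a::euclidean_space net" and z :: "real \<Rightarrow> 'a hstate"
  assumes net: "network_ok P"
    and ce: "\<And>e. e \<in> edges P \<Longrightarrow> continuous_on S (\<lambda>t. eta (z t) e)"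
    and co: "\<And>j. j \<in> buses P \<Longrightarrow> continuous_on S (\<lambda>t. omg (z t) j)"
    and cx: "\<And>j. j \<in> buses P \<Longrightarrow> continuous_on S (\<lambda>t. xsv (z t) j)"
    and W: "\<And>t j. \<lbrakk>t \<in> S; j \<in> buses P\<rbrakk> \<Longrightarrow> xsv (z t) j \<in> Ws P j"
    and sig0: "\<And>t j. sig (z t) j = 0"
  shows "e \<in> edges P \<Longrightarrow> continuous_on S (\<lambda>t. flow_eta P (z t) e)"
    and "j \<in> buses P \<Longrightarrow> continuous_on S (\<lambda>t. flow_om P (z t) j)"
    and "j \<in> buses P \<Longrightarrow> continuous_on S (\<lambda>t. flow_xs P (z t) j)"
proof -
  have sub: "edges P \<subseteq> buses P \<times> buses P" using net by (simp add: network_ok_def)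
  show "continuous_on S (\<lambda>t. flow_eta P (z t) e)" if e: "e \<in> edges P"
  proof -
    have "fst e \<in> buses P" "snd e \<in> buses P" using sub e by auto
    then show ?thesis using e unfolding flow_eta_def by (simp add: continuous_on_diff co)
  qed
  have cu: "continuous_on S (\<lambda>t. - omg (z t) j)" if "j \<in> buses P" for j
    by (intro continuous_on_minus co that)
  show "continuous_on S (\<lambda>t. flow_xs P (z t) j)" if j: "j \<in> buses P"
  proof -
    from net j have "\<exists>L. L-lipschitz_on (Ws P j \<times> UNIV) (\<lambda>(x, u). fs P j x u)"
      by (simp add: network_ok_def)
    then obtain L where "L-lipschitz_on (Ws P j \<times> UNIV) (\<lambda>(x, u). fs P j x u)" ..
    from continuous_on_lipschitz_pair[OF this cx[OF j] cu[OF j] W[OF _ j]]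
    show ?thesis using j by (simp add: flow_xs_def)
  qed
  show "continuous_on S (\<lambda>t. flow_om P (z t) j)" if j: "j \<in> buses P"
  proof -
    from net j have "\<exists>L. L-lipschitz_on (Ws P j \<times> UNIV) (\<lambda>(x, u). gs P j x u)"
      by (simp add: network_ok_def)
    then obtain L where "L-lipschitz_on (Ws P j \<times> UNIV) (\<lambda>(x, u). gs P j x u)" ..
    from continuous_on_lipschitz_pair[OF this cx[OF j] cu[OF j] W[OF _ j]]
    have g: "continuous_on S (\<lambda>t. gs P j (xsv (z t) j) (- omg (z t) j))" .
    have p: "continuous_on S (\<lambda>t. pflow P (z t) e)" if "e \<in> edges P" for e
      unfolding pflow_def by (intro continuous_intros ce that)
    have M: "Mc P j \<noteq> 0" using net j by (auto simp: network_ok_def)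
    have eq: "flow_om P (z t) j = (- pLc P j + gs P j (xsv (z t) j) (- omg (z t) j)
        - (\<Sum>k\<in>{k. (j, k) \<in> edges P}. pflow P (z t) (j, k))
        + (\<Sum>i\<in>{i. (i, j) \<in> edges P}. pflow P (z t) (i, j))) / Mc P j" for t
      using j sig0 by (simp add: flow_om_def)
    show ?thesis
      unfolding eq
      by (intro continuous_on_divide continuous_on_add continuous_on_diff continuous_on_const
          continuous_on_sum g ballI) (use M p in auto)
  qed
qed

context solution_slice
begin

lemma flows_on_frozen:
  assumes b: "0 < b" and sig0: "\<And>t j. \<lbrakk>t \<in> {0<..<b}; j \<in> buses P\<rbrakk> \<Longrightarrow> sig (z (t, 0)) j = 0"
  shows "flows_on P (frozen z) {0..b}"
proof -
  have "b / 2 \<in> interior T" using interior_slice b by auto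
  then have "interior T \<noteq> {}" by blast
  from slice_ode[OF this] obtain N0 where N0: "negligible N0 \<and> {t. \<not> (t \<in> T \<longrightarrow> ode_at t)} \<subseteq> N0" ..
  \<comment> \<open>The endpoints join the exceptional set since \<sigma> = 0 is given at interior
    times only; continuity of the right-hand side restores the equation there.\<close>
  define N where "N = insert 0 (insert b N0)"
  have N: "negligible N" using N0 by (simp add: N_def)
  have cont1: "continuous_on {0..b} (\<lambda>t. flow_eta P (frozen z t) e)" if "e \<in> edges P" for e
    by (rule continuous_on_frozen_flow(1)[OF net_ok _ _ _ _ _ that]) (simp_all add: slice_cont slice_Ws)
  have cont2: "continuous_on {0..b} (\<lambda>t. flow_om P (frozen z t) j)" if "j \<in> buses P" for j
    by (rule continuous_on_frozen_flow(2)[OF net_ok _ _ _ _ _ that]) (simp_all add: slice_cont slice_Ws)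
  have cont3: "continuous_on {0..b} (\<lambda>t. flow_xs P (frozen z t) j)" if "j \<in> buses P" for j
    by (rule continuous_on_frozen_flow(3)[OF net_ok _ _ _ _ _ that]) (simp_all add: slice_cont slice_Ws)
  have ode': "(\<forall>e\<in>edges P. ((\<lambda>s. eta (z (s, 0)) e) has_real_derivative flow_eta P (frozen z t) e) (at t within {0..b})) \<and>
     (\<forall>j\<in>buses P. ((\<lambda>s. omg (z (s, 0)) j) has_real_derivative flow_om P (frozen z t) j) (at t within {0..b}) \<and>
        ((\<lambda>s. xsv (z (s, 0)) j) has_vector_derivative flow_xs P (frozen z t) j) (at t within {0..b}))"
    if t: "t \<in> {0..b} - N" for t
  proof -
    have tT: "t \<in> T" "t \<notin> N0" "t \<in> {0<..<b}" using t slice by (auto simp: N_def)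
    have e: "flow_eta P (z (t, 0)) = flow_eta P (frozen z t)" "flow_xs P (z (t, 0)) = flow_xs P (frozen z t)"
      by (auto simp: flow_eta_def flow_xs_def fun_eq_iff)
    have o: "flow_om P (z (t, 0)) j = flow_om P (frozen z t) j" if "j \<in> buses P" for j
      by (rule flow_om_sig0) (use sig0 tT that in simp_all)
    have "ode_at t" using N0 tT(1,2) by blast
    then show ?thesis
      using slice unfolding e ode_at_def
      by (simp add: o has_field_derivative_subset[of _ _ _ T] has_vector_derivative_within_subset[of _ _ _ T])
  qed
  show ?thesis
    unfolding flows_on_def frozen_simps has_real_derivative_iff_has_vector_derivative
  proof (intro ballI conjI)
    fix t assume t: "t \<in> {0..b}"
    show "((\<lambda>s. eta (z (s, 0)) e) has_vector_derivative flow_eta P (frozen z t) e) (at t within {0..b})"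
      if e: "e \<in> edges P" for e
      by (rule abs_cont_on_has_vector_derivative[OF abs_cont_on_slice[OF slice_props(1)[OF e] slice] cont1[OF e] N _ t])
        (use ode' e in \<open>simp add: has_real_derivative_iff_has_vector_derivative\<close>)
    show "((\<lambda>s. omg (z (s, 0)) j) has_vector_derivative flow_om P (frozen z t) j) (at t within {0..b})"
      if j: "j \<in> buses P" for j
      by (rule abs_cont_on_has_vector_derivative[OF abs_cont_on_slice[OF slice_props(2)[OF j] slice] cont2[OF j] N _ t])
        (use ode' j in \<open>simp add: has_real_derivative_iff_has_vector_derivative\<close>)
    show "((\<lambda>s. xsv (z (s, 0)) j) has_vector_derivative flow_xs P (frozen z t) j) (at t within {0..b})"
      if j: "j \<in> buses P" for j
      by (rule abs_cont_on_has_vector_derivative[OF abs_cont_on_slice[OF slice_props(3)[OF j] slice] cont3[OF j] N _ t])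
        (use ode' j in simp)
  qed
qed

end

section \<open>Convergence of trapped trajectories\<close>

lemma uniformly_continuous_on_bounded_vderiv:
  fixes h :: "real \<Rightarrow> 'b::real_normed_vector"
  assumes der: "\<And>t. t \<in> S \<Longrightarrow> (h has_vector_derivative h' t) (at t within S)"
    and S: "convex S" and bd: "\<And>t. t \<in> S \<Longrightarrow> norm (h' t) \<le> B"
  shows "uniformly_continuous_on S h"
proof -
  have "norm (h y - h x) \<le> max B 0 * norm (y - x)" if "x \<in> S" "y \<in> S" for x y
  proof (rule differentiable_bound[OF S _ _ that(2,1)])
    fix t assume t: "t \<in> S"
    show "(h has_derivative (\<lambda>s. s *\<^sub>R h' t)) (at t within S)"
      using der[OF t] by (simp add: has_vector_derivative_def)
    show "onorm (\<lambda>s::real. s *\<^sub>R h' t) \<le> max B 0"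
      using bd[OF t] mult_right_mono[of "norm (h' t)" "max B 0" "norm (r::real)" for r]
      by (intro onorm_le) (simp add: mult.commute)
  qed
  then have "(max B 0)-lipschitz_on S h"
    by (intro lipschitz_onI) (auto simp: dist_norm)
  then show ?thesis by (rule lipschitz_on_uniformly_continuous)
qed

lemma uniformly_continuous_on_pair:
  fixes f :: "'x::metric_space \<Rightarrow> 'y::metric_space" and g :: "'x \<Rightarrow> 'z::metric_space"
  assumes "uniformly_continuous_on S f" "uniformly_continuous_on S g"
  shows "uniformly_continuous_on S (\<lambda>x. (f x, g x))"
  using assms unfolding uniformly_continuous_on_sequentially
proof (intro allI impI)
  fix x y assume f: "\<forall>x y. (\<forall>n. x n \<in> S) \<and> (\<forall>n. y n \<in> S) \<and> (\<lambda>n. dist (x n) (y n)) \<longlonglongrightarrow> 0 \<longrightarrow>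
      (\<lambda>n. dist (f (x n)) (f (y n))) \<longlonglongrightarrow> 0"
    and g: "\<forall>x y. (\<forall>n. x n \<in> S) \<and> (\<forall>n. y n \<in> S) \<and> (\<lambda>n. dist (x n) (y n)) \<longlonglongrightarrow> 0 \<longrightarrow>
      (\<lambda>n. dist (g (x n)) (g (y n))) \<longlonglongrightarrow> 0"
    and xy: "(\<forall>n. x n \<in> S) \<and> (\<forall>n. y n \<in> S) \<and> (\<lambda>n. dist (x n) (y n)) \<longlonglongrightarrow> 0"
  have 1: "(\<lambda>n. dist (f (x n)) (f (y n))) \<longlonglongrightarrow> 0" and 2: "(\<lambda>n. dist (g (x n)) (g (y n))) \<longlonglongrightarrow> 0"
    using f g xy by simp_all
  have "(\<lambda>n. sqrt ((dist (f (x n)) (f (y n)))\<^sup>2 + (dist (g (x n)) (g (y n)))\<^sup>2)) \<longlonglongrightarrow> sqrt (0\<^sup>2 + 0\<^sup>2)"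
    by (intro tendsto_intros 1 2)
  then show "(\<lambda>n. dist (f (x n), g (x n)) (f (y n), g (y n))) \<longlonglongrightarrow> 0"
    by (simp add: dist_Pair_Pair)
qed

lemma uniformly_continuous_on_into_compact:
  fixes p :: "'x::metric_space \<Rightarrow> 'y::metric_space" and G :: "'y \<Rightarrow> 'z::metric_space"
  assumes "uniformly_continuous_on S p" "compact C" "continuous_on C G" "\<And>t. t \<in> S \<Longrightarrow> p t \<in> C"
  shows "uniformly_continuous_on S (\<lambda>t. G (p t))"
proof (rule uniformly_continuous_on_compose[OF assms(1)])
  have "p ` S \<subseteq> C" using assms(4) by auto
  then show "uniformly_continuous_on (p ` S) G"
    using compact_uniformly_continuous[OF assms(3,2)] unfolding uniformly_continuous_on_def
    by (meson subsetD)
qed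

section \<open>Uniform dissipation on a compact local domain\<close>

context passive_network
begin

text \<open>The values of local state and frequency in the box. By compactness, continuous functions
  of them are bounded and uniformly continuous.\<close>

definition loc_dom :: "nat \<Rightarrow> ('a \<times> real) set" where
  "loc_dom j = (Ws P j \<inter> cball (xsv zs j) R) \<times> {-R..R}"

lemma compact_loc_dom: "j \<in> buses P \<Longrightarrow> compact (loc_dom j)"
  unfolding loc_dom_def by (intro compact_Times closed_Int_compact Ws_closed compact_cball compact_Icc)

lemma near_loc_dom: "\<lbrakk>near z; j \<in> buses P\<rbrakk> \<Longrightarrow> (xsv z j, omg z j) \<in> loc_dom j"
  by (auto simp: near_def loc_dom_def dist_commute abs_le_iff)

lemma continuous_on_loc_dom:
  assumes j: "j \<in> buses P"
  shows "continuous_on (loc_dom j) (\<lambda>p. fs P j (fst p) (- snd p))"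
    and "continuous_on (loc_dom j) (\<lambda>p. gs P j (fst p) (- snd p))"
    and "continuous_on (loc_dom j) (\<lambda>p. rate j (fst p) (snd p))"
proof -
  have c: "continuous_on (loc_dom j) fst" "continuous_on (loc_dom j) (\<lambda>p. - snd p)" "continuous_on (loc_dom j) snd"
    by (intro continuous_intros)+
  have W: "fst p \<in> Ws P j" if "p \<in> loc_dom j" for p using that by (auto simp: loc_dom_def)
  from fs_lip[OF j] obtain L where "L-lipschitz_on (Ws P j \<times> UNIV) (\<lambda>(x, u). fs P j x u)" ..
  from continuous_on_lipschitz_pair[OF this c(1,2) W]
  show f: "continuous_on (loc_dom j) (\<lambda>p. fs P j (fst p) (- snd p))" .
  from gs_lip[OF j] obtain L where "L-lipschitz_on (Ws P j \<times> UNIV) (\<lambda>(x, u). gs P j x u)" ..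
  from continuous_on_lipschitz_pair[OF this c(1,2) W]
  show g: "continuous_on (loc_dom j) (\<lambda>p. gs P j (fst p) (- snd p))" .
  have V: "continuous_on (loc_dom j) (\<lambda>p. V' j (fst p))"
    by (rule continuous_on_compose2[OF V'_cont[OF j] c(1)]) simp
  show "continuous_on (loc_dom j) (\<lambda>p. rate j (fst p) (snd p))"
    unfolding rate_def
    by (intro continuous_on_add blinfun.continuous_on V f continuous_on_mult c(3) continuous_on_diff g
        continuous_on_const)
qed

text \<open>The passivity margin may be discontinuous, so pointwise strictness is made uniform
  differently: the continuous \<open>rate\<close> attains its maximum on the compact part with
  frequency at least \<open>e\<close> in modulus, and that maximum is negative.\<close>

lemma rate_bounded_away:
  assumes j: "j \<in> buses P" and e: "e > 0"
  shows "\<exists>m>0. \<forall>p\<in>loc_dom j. e \<le> \<bar>snd p\<bar> \<longrightarrow> rate j (fst p) (snd p) \<le> - m"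
proof -
  let ?C = "loc_dom j \<inter> {p. e \<le> \<bar>snd p\<bar>}"
  have "closed {p :: 'a \<times> real. e \<le> \<bar>snd p\<bar>}"
    by (intro closed_Collect_le continuous_intros)
  then have C: "compact ?C" by (intro compact_Int_closed compact_loc_dom j)
  have cont: "continuous_on ?C (\<lambda>p. rate j (fst p) (snd p))"
    by (rule continuous_on_subset[OF continuous_on_loc_dom(3)[OF j]]) auto
  show ?thesis
  proof (cases "?C = {}")
    case True
    then show ?thesis by (intro exI[of _ 1]) auto
  next
    case False
    from continuous_attains_sup[OF C False cont]
    obtain q where q: "q \<in> ?C" "\<forall>p\<in>?C. rate j (fst p) (snd p) \<le> rate j (fst q) (snd q)" ..
    have "rate j (fst q) (snd q) < 0"
      using q(1) e unfolding rate_def loc_dom_def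
      by (intro dissip_strict[OF j]) (auto simp: dist_commute)
    then show ?thesis using q(2) by (intro exI[of _ "- rate j (fst q) (snd q)"]) auto
  qed
qed

end

text \<open>\<open>inv\<close> is the invariance assumption at constant frequency 0, the input to
  which every bus will be shown to converge.\<close>

locale trapped_trajectory = passive_network +
  fixes z :: "real \<Rightarrow> 'a hstate"
  assumes inv: "\<lbrakk>j \<in> buses P; C \<subseteq> Ws P j; compact C; invariant_set (Ws P j) (\<lambda>x. fs P j x 0) C\<rbrakk>
      \<Longrightarrow> \<forall>x\<in>C. fs P j x 0 = 0"
    and fl: "flows_on P z {0..}"
    and near_z: "t \<ge> 0 \<Longrightarrow> near (z t)"
    and sig0: "sig (z t) j = 0"
begin

lemma z_loc_dom: "\<lbrakk>t \<ge> 0; j \<in> buses P\<rbrakk> \<Longrightarrow> (xsv (z t) j, omg (z t) j) \<in> loc_dom j"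
  by (intro near_loc_dom near_z)

lemma z_deriv:
  assumes "t \<ge> 0"
  shows "e \<in> edges P \<Longrightarrow> ((\<lambda>s. eta (z s) e) has_real_derivative flow_eta P (z t) e) (at t within {0..})"
    and "j \<in> buses P \<Longrightarrow> ((\<lambda>s. omg (z s) j) has_real_derivative flow_om P (z t) j) (at t within {0..})"
    and "j \<in> buses P \<Longrightarrow> ((\<lambda>s. xsv (z s) j) has_vector_derivative fs P j (xsv (z t) j) (- omg (z t) j)) (at t within {0..})"
  using fl assms by (auto simp: flows_on_def flow_xs_def)

lemma flow_om_eq:
  "j \<in> buses P \<Longrightarrow> flow_om P (z t) j = (- pLc P j + gs P j (xsv (z t) j) (- omg (z t) j)
        - (\<Sum>k\<in>{k. (j, k) \<in> edges P}. pflow P (z t) (j, k))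
        + (\<Sum>i\<in>{i. (i, j) \<in> edges P}. pflow P (z t) (i, j))) / Mc P j"
  using sig0 by (simp add: flow_om_def)

lemma om_bound: "\<lbrakk>t \<ge> 0; j \<in> buses P\<rbrakk> \<Longrightarrow> \<bar>omg (z t) j\<bar> \<le> R"
  using near_z by (simp add: near_def)

text \<open>The local output is continuous on a compact set, and sine is bounded. The bound yields
  uniform continuity of the frequency.\<close>

lemma flow_om_bounded:
  assumes j: "j \<in> buses P"
  shows "\<exists>B. \<forall>t\<ge>0. \<bar>flow_om P (z t) j\<bar> \<le> B"
proof -
  have "bounded ((\<lambda>p. gs P j (fst p) (- snd p)) ` loc_dom j)"
    by (intro compact_imp_bounded compact_continuous_image continuous_on_loc_dom compact_loc_dom j)
  then obtain G where G: "\<forall>p\<in>loc_dom j. \<bar>gs P j (fst p) (- snd p)\<bar> \<le> G"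
    unfolding bounded_iff by auto
  let ?S1 = "\<Sum>k\<in>{k. (j, k) \<in> edges P}. Bc P (j, k)" and ?S2 = "\<Sum>i\<in>{i. (i, j) \<in> edges P}. Bc P (i, j)"
  have p: "\<bar>pflow P (z t) e\<bar> \<le> Bc P e" if "e \<in> edges P" for t e
    using B_pos[OF that] abs_sin_le_one[of "eta (z t) e"]
    by (simp add: pflow_def abs_mult mult_left_le)
  have "\<bar>flow_om P (z t) j\<bar> \<le> (\<bar>pLc P j\<bar> + G + ?S1 + ?S2) / Mc P j" if t: "t \<ge> 0" for t
  proof -
    have "\<bar>\<Sum>k\<in>{k. (j, k) \<in> edges P}. pflow P (z t) (j, k)\<bar> \<le> ?S1"
      by (rule order_trans[OF sum_abs sum_mono]) (use p in auto)
    moreover have "\<bar>\<Sum>i\<in>{i. (i, j) \<in> edges P}. pflow P (z t) (i, j)\<bar> \<le> ?S2"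
      by (rule order_trans[OF sum_abs sum_mono]) (use p in auto)
    moreover have "\<bar>gs P j (xsv (z t) j) (- omg (z t) j)\<bar> \<le> G"
      using G z_loc_dom[OF t j] by force
    ultimately show ?thesis
      unfolding flow_om_eq[OF j] abs_divide using M_pos[OF j] by (intro frac_le) auto
  qed
  then show ?thesis by blast
qed

lemma uc_om: "j \<in> buses P \<Longrightarrow> uniformly_continuous_on {0..} (\<lambda>t. omg (z t) j)"
proof -
  assume j: "j \<in> buses P"
  from flow_om_bounded[OF j] obtain B where "\<forall>t\<ge>0. \<bar>flow_om P (z t) j\<bar> \<le> B" ..
  then show ?thesis
    using z_deriv(2)[OF _ j] unfolding has_real_derivative_iff_has_vector_derivative
    by (intro uniformly_continuous_on_bounded_vderiv[of _ _ "\<lambda>t. flow_om P (z t) j" B]) auto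
qed

lemma uc_xs: "j \<in> buses P \<Longrightarrow> uniformly_continuous_on {0..} (\<lambda>t. xsv (z t) j)"
proof -
  assume j: "j \<in> buses P"
  have "bounded ((\<lambda>p. fs P j (fst p) (- snd p)) ` loc_dom j)"
    by (intro compact_imp_bounded compact_continuous_image continuous_on_loc_dom compact_loc_dom j)
  then obtain B where B: "\<forall>p\<in>loc_dom j. norm (fs P j (fst p) (- snd p)) \<le> B"
    unfolding bounded_iff by auto
  have "norm (fs P j (xsv (z t) j) (- omg (z t) j)) \<le> B" if "t \<ge> 0" for t
    using B z_loc_dom[OF that j] by force
  then show ?thesis
    using z_deriv(3)[OF _ j] by (intro uniformly_continuous_on_bounded_vderiv) auto
qed

lemma uc_eta: "e \<in> edges P \<Longrightarrow> uniformly_continuous_on {0..} (\<lambda>t. eta (z t) e)"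
proof -
  assume e: "e \<in> edges P"
  have se: "fst e \<in> buses P" "snd e \<in> buses P" using edges_sub e by auto
  have "\<bar>flow_eta P (z t) e\<bar> \<le> R + R" if "t \<ge> 0" for t
    using om_bound[OF that se(1)] om_bound[OF that se(2)] e unfolding flow_eta_def by simp
  then show ?thesis
    using z_deriv(1)[OF _ e] unfolding has_real_derivative_iff_has_vector_derivative
    by (intro uniformly_continuous_on_bounded_vderiv[of _ _ "\<lambda>t. flow_eta P (z t) e" "R + R"]) auto
qed

lemma uc_loc:
  fixes G :: "'a \<times> real \<Rightarrow> 'b::metric_space"
  assumes "j \<in> buses P" "continuous_on (loc_dom j) G"
  shows "uniformly_continuous_on {0..} (\<lambda>t. G (xsv (z t) j, omg (z t) j))"
  by (rule uniformly_continuous_on_into_compact[OF uniformly_continuous_on_pair[OF uc_xs[OF assms(1)] uc_om[OF assms(1)]]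
      compact_loc_dom[OF assms(1)] assms(2)]) (use assms z_loc_dom in auto)

text \<open>This prepares the second use of Barbalat, with the frequency as the convergent
  function.\<close>

lemma uc_flow_om:
  assumes j: "j \<in> buses P"
  shows "uniformly_continuous_on {0..} (\<lambda>t. flow_om P (z t) j)"
proof -
  have g: "uniformly_continuous_on {0..} (\<lambda>t. gs P j (xsv (z t) j) (- omg (z t) j))"
    using uc_loc[OF j continuous_on_loc_dom(2)[OF j]] by simp
  have p: "uniformly_continuous_on {0..} (\<lambda>t. pflow P (z t) e)" if e: "e \<in> edges P" for e
    unfolding pflow_def
  proof (rule uniformly_continuous_on_cmul_left)
    show "uniformly_continuous_on {0..} (\<lambda>t. sin (eta (z t) e))"
    proof (rule uniformly_continuous_on_into_compact[OF uc_eta[OF e]])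
      show "compact {eta zs e - R..eta zs e + R}" by simp
      show "continuous_on {eta zs e - R..eta zs e + R} sin" by (intro continuous_intros)
      show "eta (z t) e \<in> {eta zs e - R..eta zs e + R}" if "t \<in> {0..}" for t
      proof -
        have "\<bar>eta (z t) e - eta zs e\<bar> \<le> R" using near_z that e by (simp add: near_def)
        then show ?thesis by (simp add: abs_le_iff)
      qed
    qed
  qed
  show ?thesis
    unfolding flow_om_eq[OF j] divide_inverse
    by (intro uniformly_continuous_on_cmul_right uniformly_continuous_on_add uniformly_continuous_on_diff
        uniformly_continuous_on_sum g uniformly_continuous_on_const) (use p in auto)
qed

text \<open>No local rate is positive, so the sum can tend to 0 only if each rate does; a rate near
  0 in turn rules out a frequency of modulus at least \<open>e\<close>.\<close>

lemma om_tendsto_0: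
  assumes j: "j \<in> buses P"
  shows "((\<lambda>t. omg (z t) j) \<longlongrightarrow> 0) at_top"
proof -
  let ?g = "\<lambda>t. \<Sum>j\<in>buses P. rate j (xsv (z t) j) (omg (z t) j)"
  have der: "((\<lambda>s. lyap (z s)) has_real_derivative ?g t) (at t within {0..})" if "t \<ge> 0" for t
    by (rule lyap_has_derivative[OF fl]) (use that sig0 in auto)
  have dec: "lyap (z t) \<le> lyap (z s)" if "0 \<le> s" "s \<le> t" for s t
    by (rule lyap_nonincreasing[OF fl]) (use that near_z sig0 in auto)
  have ge0: "0 \<le> lyap (z t)" if "t \<ge> 0" for t
    using lyap_ge_terms(4) near_z that by blast
  obtain l where l: "((\<lambda>t. lyap (z t)) \<longlongrightarrow> l) at_top"
    by (rule decreasing_bounded_tendsto[OF dec ge0])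
  have uc: "uniformly_continuous_on {0..} ?g"
    using uc_loc[OF _ continuous_on_loc_dom(3)] by (intro uniformly_continuous_on_sum) simp
  have g0: "(?g \<longlongrightarrow> 0) at_top" by (rule barbalat[OF der l uc])
  show ?thesis
  proof (rule tendstoI)
    fix e :: real assume "e > 0"
    from rate_bounded_away[OF j this] obtain m where m: "m > 0 \<and>
      (\<forall>p\<in>loc_dom j. e \<le> \<bar>snd p\<bar> \<longrightarrow> rate j (fst p) (snd p) \<le> - m)" ..
    have "\<forall>\<^sub>F t in at_top. dist (?g t) 0 < m" by (rule tendstoD[OF g0]) (use m in simp)
    moreover have "\<forall>\<^sub>F t in at_top. (t::real) \<ge> 0" by (rule eventually_ge_at_top)
    ultimately show "\<forall>\<^sub>F t in at_top. dist (omg (z t) j) 0 < e"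
    proof eventually_elim
      case (elim t)
      have le0: "rate i (xsv (z t) i) (omg (z t) i) \<le> 0" if "i \<in> buses P" for i
        using rate_nonpos near_z elim(2) that by blast
      have "?g t = rate j (xsv (z t) j) (omg (z t) j) + (\<Sum>i\<in>buses P - {j}. rate i (xsv (z t) i) (omg (z t) i))"
        by (rule sum.remove[OF finite_buses j])
      also have "\<dots> \<le> rate j (xsv (z t) j) (omg (z t) j)"
        using sum_nonpos[of "buses P - {j}" "\<lambda>i. rate i (xsv (z t) i) (omg (z t) i)"] le0 by simp
      finally have "- m < rate j (xsv (z t) j) (omg (z t) j)" using elim(1) by (simp add: dist_real_def)
      moreover have "rate j (xsv (z t) j) (omg (z t) j) \<le> - m" if "e \<le> \<bar>omg (z t) j\<bar>"
        using m z_loc_dom[OF elim(2) j] that by force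
      ultimately show ?case unfolding dist_real_def by (metis diff_zero not_le)
    qed
  qed
qed

lemma flow_om_tendsto_0: "j \<in> buses P \<Longrightarrow> ((\<lambda>t. flow_om P (z t) j) \<longlongrightarrow> 0) at_top"
  by (rule barbalat[OF z_deriv(2) om_tendsto_0 uc_flow_om])

end

lemma tendsto_at_top_sequentially:
  "\<lbrakk>(f \<longlongrightarrow> l) at_top; filterlim s at_top sequentially\<rbrakk> \<Longrightarrow> (\<lambda>n. f (s n)) \<longlonglongrightarrow> l"
  by (rule filterlim_compose)

section \<open>Limit points are equilibria\<close>

context trapped_trajectory
begin

text \<open>The flow vanishes for three reasons: on the edges because all frequencies tend to 0, in
  the frequencies because their derivatives tend to 0, and in the local states by invariance of the
  limit set. Components off the network are set to 0 so that \<open>w\<close> lies in the state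
  space.\<close>

lemma limit_equilibrium:
  assumes s: "filterlim s at_top sequentially" and s0: "\<And>n. s n \<ge> 0"
    and le: "\<And>e. e \<in> edges P \<Longrightarrow> (\<lambda>n. eta (z (s n)) e) \<longlonglongrightarrow> el e"
    and lx: "\<And>j. j \<in> buses P \<Longrightarrow> (\<lambda>n. xsv (z (s n)) j) \<longlonglongrightarrow> xl j"
  defines "w \<equiv> ((\<lambda>e. if e \<in> edges P then el e else 0, \<lambda>_. 0, \<lambda>j. if j \<in> buses P then xl j else 0), \<lambda>_. 0)"
  shows "equilibrium P w" and "(\<lambda>n. zdist P (z (s n)) w) \<longlonglongrightarrow> 0"
proof -
  have w: "eta w = (\<lambda>e. if e \<in> edges P then el e else 0)" "omg w = (\<lambda>_. 0)"
    "xsv w = (\<lambda>j. if j \<in> buses P then xl j else 0)" "sig w = (\<lambda>_. 0)"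
    by (simp_all add: w_def eta_def omg_def xsv_def sig_def)
  have lo: "(\<lambda>n. omg (z (s n)) j) \<longlonglongrightarrow> 0" if "j \<in> buses P" for j
    by (rule tendsto_at_top_sequentially[OF om_tendsto_0[OF that] s])
  have zW: "xsv (z t) j \<in> Ws P j" if "j \<in> buses P" "t \<ge> 0" for t j
    using near_z[OF that(2)] that(1) by (simp add: near_def)
  have xlW: "xl j \<in> Ws P j" if "j \<in> buses P" for j
    by (rule closed_sequentially[OF Ws_closed[OF that] _ lx[OF that]]) (rule zW[OF that s0])
  have fs0: "fs P j (xl j) 0 = 0" if j: "j \<in> buses P" for j
  proof -
    from fs_lip[OF j] obtain L where L: "L-lipschitz_on (Ws P j \<times> UNIV) (\<lambda>(x, u). fs P j x u)" ..
    have "bounded ((\<lambda>t. xsv (z t) j) ` {0..})"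
    proof (rule bounded_subset[OF bounded_cball[of "xsv zs j" R]])
      show "(\<lambda>t. xsv (z t) j) ` {0..} \<subseteq> cball (xsv zs j) R"
        using near_z j by (auto simp: near_def dist_commute)
    qed
    moreover have "((\<lambda>t. - omg (z t) j) \<longlongrightarrow> 0) at_top"
      using tendsto_minus[OF om_tendsto_0[OF j]] by simp
    ultimately show ?thesis
      by (intro asymptotic_limit_equilibrium[OF Ws_closed[OF j] L z_deriv(3)[OF _ j] zW[OF j] _ _ inv[OF j] s lx[OF j]])
  qed
  have fo0: "flow_om P w j = 0" if j: "j \<in> buses P" for j
  proof -
    from gs_lip[OF j] obtain L where L: "L-lipschitz_on (Ws P j \<times> UNIV) (\<lambda>(x, u). gs P j x u)" ..
    have "(\<lambda>n. dist (gs P j (xsv (z (s n)) j) (- omg (z (s n)) j)) (gs P j (xl j) 0)) \<longlonglongrightarrow> 0"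
    proof (rule tendsto_sandwich[OF _ _ tendsto_const])
      show "\<forall>\<^sub>F n in sequentially. 0 \<le> dist (gs P j (xsv (z (s n)) j) (- omg (z (s n)) j)) (gs P j (xl j) 0)"
        by simp
      show "\<forall>\<^sub>F n in sequentially. dist (gs P j (xsv (z (s n)) j) (- omg (z (s n)) j)) (gs P j (xl j) 0)
          \<le> L * (dist (xsv (z (s n)) j) (xl j) + dist (- omg (z (s n)) j) 0)"
        by (intro always_eventually allI lipschitz_on_pair_bound[OF L] zW[OF j] s0 xlW[OF j])
      have "(\<lambda>n. L * (dist (xsv (z (s n)) j) (xl j) + dist (- omg (z (s n)) j) 0))
          \<longlonglongrightarrow> L * (dist (xl j) (xl j) + dist (- 0) (0::real))"
        by (intro tendsto_intros lx[OF j] lo[OF j])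
      then show "(\<lambda>n. L * (dist (xsv (z (s n)) j) (xl j) + dist (- omg (z (s n)) j) 0)) \<longlonglongrightarrow> 0"
        by simp
    qed
    then have g: "(\<lambda>n. gs P j (xsv (z (s n)) j) (- omg (z (s n)) j)) \<longlonglongrightarrow> gs P j (xl j) 0"
      using tendsto_dist_iff by blast
    have p: "(\<lambda>n. pflow P (z (s n)) e) \<longlonglongrightarrow> pflow P w e" if "e \<in> edges P" for e
      using le[OF that] that unfolding pflow_def w by (auto intro!: tendsto_intros)
    have "(\<lambda>n. flow_om P (z (s n)) j) \<longlonglongrightarrow> (- pLc P j + gs P j (xl j) 0
        - (\<Sum>k\<in>{k. (j, k) \<in> edges P}. pflow P w (j, k))
        + (\<Sum>i\<in>{i. (i, j) \<in> edges P}. pflow P w (i, j))) / Mc P j"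
      unfolding flow_om_eq[OF j] using M_pos[OF j]
      by (intro tendsto_divide tendsto_add tendsto_diff tendsto_const g tendsto_sum p) auto
    then have "(\<lambda>n. flow_om P (z (s n)) j) \<longlonglongrightarrow> flow_om P w j"
      using j by (simp add: flow_om_def w)
    moreover have "(\<lambda>n. flow_om P (z (s n)) j) \<longlonglongrightarrow> 0"
      by (rule tendsto_at_top_sequentially[OF flow_om_tendsto_0[OF j] s])
    ultimately show ?thesis by (rule LIMSEQ_unique)
  qed
  have om01: "0 < om0 P j" "0 < om1 P j" if "j \<in> buses P" for j
    using net that by (force simp: network_ok_def)+
  have "Iset P j 0 = {0}" if "j \<in> buses P" for j
    using om01[OF that] by (simp add: Iset_def)
  then have "w \<in> Cset P"
    using xlW unfolding Cset_def by (simp add: w) (simp add: w_def state_space_def)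
  \<comment> \<open>At frequency 0 no threshold is met, since all thresholds are positive.\<close>
  moreover have "w \<notin> Dset P"
    unfolding Dset_def by (simp add: w) (metis om01 order_less_irrefl hsgn_def)
  moreover have "flowmap P w = ((\<lambda>_. 0, \<lambda>_. 0, \<lambda>_. 0), (\<lambda>_. 0))"
  proof -
    have "flow_eta P w = (\<lambda>_. 0)" by (simp add: flow_eta_def w fun_eq_iff)
    moreover have "flow_om P w = (\<lambda>_. 0)"
    proof
      fix j show "flow_om P w j = 0"
        by (cases "j \<in> buses P") (simp add: fo0, simp add: flow_om_def)
    qed
    moreover have "flow_xs P w = (\<lambda>_. 0)" using fs0 by (simp add: flow_xs_def w fun_eq_iff)
    ultimately show ?thesis by (simp add: flowmap_def)
  qed
  ultimately show "equilibrium P w" unfolding equilibrium_def by simp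
  have "(\<lambda>n. zdist P (z (s n)) w) \<longlonglongrightarrow> (\<Sum>e\<in>edges P. \<bar>el e - el e\<bar>) + (\<Sum>j\<in>buses P. \<bar>0\<bar>)
      + (\<Sum>j\<in>buses P. norm (xl j - xl j)) + (\<Sum>j\<in>buses P. 0)"
    unfolding zdist_def
    by (intro tendsto_add tendsto_sum) (use le lo lx sig0 in \<open>auto simp: w intro!: tendsto_eq_intros\<close>)
  then show "(\<lambda>n. zdist P (z (s n)) w) \<longlonglongrightarrow> 0" by simp
qed

text \<open>Otherwise some times tending to infinity stay \<epsilon>-far from all equilibria, yet
  boundedness yields a subsequence converging to one. The frequencies already converge and need no
  extraction.\<close>

lemma converges_to_equilibria:
  assumes \<epsilon>: "\<epsilon> > 0"
  shows "\<exists>T. \<forall>t\<ge>T. \<exists>w. equilibrium P w \<and> zdist P (z t) w < \<epsilon>"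
proof (rule ccontr)
  assume "\<not> ?thesis"
  then have "\<forall>n::nat. \<exists>t. real n \<le> t \<and> \<not> (\<exists>w. equilibrium P w \<and> zdist P (z t) w < \<epsilon>)"
    by auto
  from choice[OF this] obtain s where
    s: "\<forall>n. real n \<le> s n \<and> \<not> (\<exists>w. equilibrium P w \<and> zdist P (z (s n)) w < \<epsilon>)" ..
  have s0: "s n \<ge> 0" for n using s[rule_format, of n] by linarith
  have "bounded (range (\<lambda>n. eta (z (s n)) e))" if "e \<in> edges P" for e
  proof (rule bounded_subset[OF bounded_cball[of "eta zs e" R]])
    show "range (\<lambda>n. eta (z (s n)) e) \<subseteq> cball (eta zs e) R"
      using near_z[OF s0] that by (auto simp: near_def dist_real_def abs_minus_commute)
  qed
  from common_convergent_subseq[OF finite_edges this] obtain r1 where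
    r1: "strict_mono r1 \<and> (\<forall>e\<in>edges P. convergent ((\<lambda>n. eta (z (s n)) e) \<circ> r1))" ..
  have "bounded (range (\<lambda>n. xsv (z (s (r1 n))) j))" if "j \<in> buses P" for j
  proof (rule bounded_subset[OF bounded_cball[of "xsv zs j" R]])
    show "range (\<lambda>n. xsv (z (s (r1 n))) j) \<subseteq> cball (xsv zs j) R"
      using near_z[OF s0] that by (auto simp: near_def dist_commute)
  qed
  from common_convergent_subseq[OF finite_buses this] obtain r2 where
    r2: "strict_mono r2 \<and> (\<forall>j\<in>buses P. convergent ((\<lambda>n. xsv (z (s (r1 n))) j) \<circ> r2))" ..
  define q where "q = (\<lambda>n. s (r1 (r2 n)))"
  have "strict_mono (r1 \<circ> r2)" using r1 r2 by (simp add: strict_mono_o)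
  then have r12: "n \<le> r1 (r2 n)" for n using strict_mono_imp_increasing by fastforce
  have q: "filterlim q at_top sequentially"
  proof (rule filterlim_at_top_mono[OF filterlim_real_sequentially])
    show "\<forall>\<^sub>F n in sequentially. real n \<le> q n"
      using s r12 unfolding q_def by (intro always_eventually allI) (meson of_nat_mono order_trans)
  qed
  have q0: "q n \<ge> 0" for n using s0 by (simp add: q_def)
  have ce: "(\<lambda>n. eta (z (q n)) e) \<longlonglongrightarrow> lim (\<lambda>n. eta (z (q n)) e)" if "e \<in> edges P" for e
  proof -
    have "convergent (((\<lambda>n. eta (z (s n)) e) \<circ> r1) \<circ> r2)"
      using r1 r2 that convergent_subseq_convergent by blast
    then show ?thesis by (simp add: o_def q_def convergent_LIMSEQ_iff)
  qed
  have cx: "(\<lambda>n. xsv (z (q n)) j) \<longlonglongrightarrow> lim (\<lambda>n. xsv (z (q n)) j)" if "j \<in> buses P" for j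
  proof -
    have "convergent ((\<lambda>n. xsv (z (s (r1 n))) j) \<circ> r2)" using r2 that by blast
    then show ?thesis by (simp add: o_def q_def convergent_LIMSEQ_iff)
  qed
  obtain w where w: "equilibrium P w" "(\<lambda>n. zdist P (z (q n)) w) \<longlonglongrightarrow> 0"
    by (rule that[OF limit_equilibrium[OF q q0 ce cx]])
  have "\<forall>\<^sub>F n in sequentially. dist (zdist P (z (q n)) w) 0 < \<epsilon>"
    by (rule tendstoD[OF w(2) \<epsilon>])
  then obtain n where "dist (zdist P (z (q n)) w) 0 < \<epsilon>"
    using eventually_happens'[OF sequentially_bot] by fast
  then have "zdist P (z (s (r1 (r2 n)))) w < \<epsilon>" by (simp add: q_def dist_real_def)
  then show False using s w(1) by blast
qed

end

section \<open>Hybrid time domains\<close>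

text \<open>A finite union of bounded pieces is bounded in total time. The other domains have
  infinitely many pieces or end in an unbounded one, and they contain the jump at
  \<open>tt 1\<close> unless the unbounded piece is the very first.\<close>

lemma hybrid_time_domain_cases:
  assumes "hybrid_time_domain K"
  shows "(\<exists>t. (t, 0) \<in> K \<and> (t, 1) \<in> K) \<or> (\<exists>B. \<forall>t l. (t, l) \<in> K \<longrightarrow> t + real l \<le> B) \<or> K = {0..} \<times> {0}"
proof -
  from assms[unfolded hybrid_time_domain_def] obtain tt :: "nat \<Rightarrow> real" where tt: "tt 0 = 0 \<and> mono tt \<and>
     (K = (\<Union>l. {tt l..tt (Suc l)} \<times> {l}) \<or>
      (\<exists>J. K = (\<Union>l<J. {tt l..tt (Suc l)} \<times> {l}) \<union> ({tt J..tt (Suc J)} \<times> {J}) \<or>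
           K = (\<Union>l<J. {tt l..tt (Suc l)} \<times> {l}) \<union> ({tt J..<tt (Suc J)} \<times> {J}) \<or>
           K = (\<Union>l<J. {tt l..tt (Suc l)} \<times> {l}) \<union> ({tt J..} \<times> {J})))" ..
  then have tt0: "tt 0 = 0" and mono: "mono tt" by simp_all
  have le: "tt i \<le> tt j" if "i \<le> j" for i j using mono that by (rule monoD)
  have in0: "tt 1 \<in> {tt 0..tt (Suc 0)}" and in1: "tt 1 \<in> {tt 1..tt (Suc 1)}"
    using le[of 0 1] le[of 1 "Suc 1"] by simp_all
  have fin: "\<exists>B. \<forall>t l. (t, l) \<in> K \<longrightarrow> t + real l \<le> B"
    if K: "K \<subseteq> (\<Union>l<J. {tt l..tt (Suc l)} \<times> {l}) \<union> ({tt J..tt (Suc J)} \<times> {J})" for J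
  proof (intro exI allI impI)
    fix t l assume "(t, l) \<in> K"
    then have "t \<le> tt (Suc l)" "l \<le> J" using K by auto
    then show "t + real l \<le> tt (Suc J) + real J" using le[of "Suc l" "Suc J"] by simp
  qed
  from tt consider "K = (\<Union>l. {tt l..tt (Suc l)} \<times> {l})"
    | J where "K = (\<Union>l<J. {tt l..tt (Suc l)} \<times> {l}) \<union> ({tt J..tt (Suc J)} \<times> {J})"
    | J where "K = (\<Union>l<J. {tt l..tt (Suc l)} \<times> {l}) \<union> ({tt J..<tt (Suc J)} \<times> {J})"
    | J where "K = (\<Union>l<J. {tt l..tt (Suc l)} \<times> {l}) \<union> ({tt J..} \<times> {J})"
    by (elim conjE disjE exE) simp_all
  then show ?thesis
  proof cases
    case 1
    have "(tt 1, 0) \<in> K" "(tt 1, 1) \<in> K" using in0 in1 unfolding 1 by auto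
    then show ?thesis by blast
  next
    case (2 J)
    then show ?thesis using fin[of J] by simp
  next
    case (3 J)
    have "K \<subseteq> (\<Union>l<J. {tt l..tt (Suc l)} \<times> {l}) \<union> ({tt J..tt (Suc J)} \<times> {J})"
      unfolding 3 by (intro Un_mono order_refl Sigma_mono) auto
    then show ?thesis using fin[of J] by simp
  next
    case (4 J)
    show ?thesis
    proof (cases J)
      case 0
      then have "K = {0..} \<times> {0}" using tt0 unfolding 4 by simp
      then show ?thesis by simp
    next
      case (Suc i)
      have "(tt 1, 0) \<in> K" using in0 Suc unfolding 4 by force
      moreover have "(tt 1, 1) \<in> K"
      proof (cases i)
        case 0
        then show ?thesis using Suc unfolding 4 by simp
      next
        case (Suc k)
        then have "1 < J" using \<open>J = Suc i\<close> by simp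
        then show ?thesis using in1 unfolding 4 by force
      qed
      ultimately show ?thesis by blast
    qed
  qed
qed

lemma hybrid_time_domain_slice:
  assumes "hybrid_time_domain K" "(t, 0) \<in> K"
  shows "0 \<le> t \<and> {0..t} \<subseteq> {s. (s, 0) \<in> K}"
proof -
  from assms(1)[unfolded hybrid_time_domain_def] obtain tt :: "nat \<Rightarrow> real" where tt: "tt 0 = 0 \<and> mono tt \<and>
     (K = (\<Union>l. {tt l..tt (Suc l)} \<times> {l}) \<or>
      (\<exists>J. K = (\<Union>l<J. {tt l..tt (Suc l)} \<times> {l}) \<union> ({tt J..tt (Suc J)} \<times> {J}) \<or>
           K = (\<Union>l<J. {tt l..tt (Suc l)} \<times> {l}) \<union> ({tt J..<tt (Suc J)} \<times> {J}) \<or>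
           K = (\<Union>l<J. {tt l..tt (Suc l)} \<times> {l}) \<union> ({tt J..} \<times> {J})))" ..
  then have tt0: "tt 0 = 0" by simp
  from tt consider "K = (\<Union>l. {tt l..tt (Suc l)} \<times> {l})"
    | J where "K = (\<Union>l<J. {tt l..tt (Suc l)} \<times> {l}) \<union> ({tt J..tt (Suc J)} \<times> {J})"
    | J where "K = (\<Union>l<J. {tt l..tt (Suc l)} \<times> {l}) \<union> ({tt J..<tt (Suc J)} \<times> {J})"
    | J where "K = (\<Union>l<J. {tt l..tt (Suc l)} \<times> {l}) \<union> ({tt J..} \<times> {J})"
    by (elim conjE disjE exE) simp_all
  then show ?thesis
  proof cases
    case 1 then show ?thesis using assms(2) tt0 by auto
  next
    case (2 J) then show ?thesis using assms(2) tt0 by (cases J) auto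
  next
    case (3 J) then show ?thesis using assms(2) tt0 by (cases J) auto
  next
    case (4 J) then show ?thesis using assms(2) tt0 by (cases J) auto
  qed
qed

lemma flows_on_all:
  assumes "\<And>b. b > 0 \<Longrightarrow> flows_on P z {0..b}"
  shows "flows_on P z {0..}"
proof -
  \<comment> \<open>A derivative at \<open>t\<close> sees only nearby times, and \<open>t\<close> is
    never the right end of \<open>{0..t + 1}\<close>.\<close>
  have eq: "at t within {0..t + 1} = at t within {0..}" for t :: real
    by (rule at_within_nhd[of t "{..<t + 1}"]) auto
  show ?thesis
    unfolding flows_on_def
  proof
    fix t :: real assume t: "t \<in> {0..}"
    then have "flows_on P z {0..t + 1}" by (intro assms) auto
    then show "(\<forall>e\<in>edges P. ((\<lambda>s. eta (z s) e) has_real_derivative flow_eta P (z t) e) (at t within {0..})) \<and>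
     (\<forall>j\<in>buses P. ((\<lambda>s. omg (z s) j) has_real_derivative flow_om P (z t) j) (at t within {0..}) \<and>
        ((\<lambda>s. xsv (z s) j) has_vector_derivative flow_xs P (z t) j) (at t within {0..}))"
      using t unfolding flows_on_def by (drule_tac bspec[of _ _ t]) (simp_all add: eq)
  qed
qed

section \<open>Basin of attraction and confinement of hybrid solutions\<close>

context passive_network
begin

text \<open>The sublevel condition alone would not do: outside the box the edge potentials have a
  linear term and the storage functions are only locally minimal, so \<open>lyap\<close> may be
  small there too.\<close>

definition basin :: "real \<Rightarrow> 'a cstate set" where
  "basin c = {x \<in> state_space P. inside (x, \<lambda>_. 0) \<and> lyap (x, \<lambda>_. 0) < c}"

text \<open>Both conditions involve finitely many coordinates, each of them continuous for the
  product topology on functions.\<close>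

lemma openin_basin: "openin (top_of_set (state_space P)) (basin c)"
proof -
  have ce: "continuous_on UNIV (\<lambda>x :: 'a cstate. eta (x, \<lambda>_. 0) e)" for e
    unfolding eta_def fst_conv
    by (rule continuous_on_compose2[OF continuous_on_product_coordinates continuous_on_fst[OF continuous_on_id]]) simp
  have co: "continuous_on UNIV (\<lambda>x :: 'a cstate. omg (x, \<lambda>_. 0) j)" for j
    unfolding omg_def fst_conv
    by (rule continuous_on_compose2[OF continuous_on_product_coordinates
          continuous_on_fst[OF continuous_on_snd[OF continuous_on_id]]]) simp
  have cx: "continuous_on UNIV (\<lambda>x :: 'a cstate. xsv (x, \<lambda>_. 0) j)" for j
    unfolding xsv_def fst_conv
    by (rule continuous_on_compose2[OF continuous_on_product_coordinates
          continuous_on_snd[OF continuous_on_snd[OF continuous_on_id]]]) simp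
  have cV: "continuous_on UNIV (\<lambda>x :: 'a cstate. V j (xsv (x, \<lambda>_. 0) j))" if "j \<in> buses P" for j
  proof (rule continuous_on_compose2[OF _ cx])
    show "continuous_on UNIV (V j)"
      by (intro continuous_at_imp_continuous_on ballI has_derivative_continuous[OF V_deriv[OF that]])
  qed simp
  have "continuous_on UNIV (\<lambda>x :: 'a cstate. lyap (x, \<lambda>_. 0))"
    unfolding lyap_def edge_energy_def
    by (intro continuous_on_add continuous_on_sum continuous_on_mult continuous_on_diff continuous_on_divide
        continuous_on_power continuous_on_const continuous_on_cos ce co cV) auto
  then have "open {x :: 'a cstate. lyap (x, \<lambda>_. 0) < c}"
    by (intro open_Collect_less continuous_on_const)
  moreover have "open {x :: 'a cstate. inside (x, \<lambda>_. 0)}"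
  proof -
    have "{x :: 'a cstate. inside (x, \<lambda>_. 0)} =
        (\<Inter>e\<in>edges P. {x. \<bar>eta (x, \<lambda>_. 0) e - eta zs e\<bar> < R}) \<inter>
        (\<Inter>j\<in>buses P. {x. \<bar>omg (x, \<lambda>_. 0) j\<bar> < R}) \<inter>
        (\<Inter>j\<in>buses P. {x. dist (xsv (x, \<lambda>_. 0) j) (xsv zs j) < R})"
      unfolding inside_def by auto
    also have "open \<dots>"
      by (intro open_Int open_INT finite_edges finite_buses ballI open_Collect_less continuous_on_const
          continuous_on_rabs continuous_on_diff continuous_on_dist ce co cx)
    finally show ?thesis .
  qed
  ultimately have "open ({x :: 'a cstate. inside (x, \<lambda>_. 0)} \<inter> {x. lyap (x, \<lambda>_. 0) < c})"
    by (intro open_Int)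
  moreover have "basin c = state_space P \<inter> ({x. inside (x, \<lambda>_. 0)} \<inter> {x. lyap (x, \<lambda>_. 0) < c})"
    by (auto simp: basin_def)
  ultimately show ?thesis by (auto simp: openin_open)
qed

lemma inside_sig_0:
  assumes "z \<in> Cset P" "inside z" "j \<in> buses P"
  shows "sig z j = 0"
proof -
  have "\<bar>omg z j\<bar> < om0 P j" using assms(2,3) R_om[OF assms(3)] by (auto simp: inside_def)
  moreover have "om0 P j < om1 P j" using net assms(3) by (simp add: network_ok_def)
  moreover have "sig z j \<in> Iset P j (omg z j)" using assms(1,3) by (simp add: Cset_def)
  ultimately show ?thesis by (simp add: Iset_def)
qed

lemma inside_not_Dset:
  assumes "inside z"
  shows "z \<notin> Dset P"
proof
  assume "z \<in> Dset P"
  then obtain j where j: "j \<in> buses P" "\<bar>omg z j\<bar> = om1 P j \<or> \<bar>omg z j\<bar> = om0 P j"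
    unfolding Dset_def by blast
  moreover have "om0 P j < om1 P j" using net j(1) by (simp add: network_ok_def)
  moreover have "\<bar>omg z j\<bar> < om0 P j" using assms j(1) R_om[OF j(1)] by (auto simp: inside_def)
  ultimately show False by linarith
qed

lemma inside_frozen [simp]: "inside (frozen z t) \<longleftrightarrow> inside (z (t, 0))"
  by (simp add: inside_def)

text \<open>Confinement and \<sigma> = 0 seem to presuppose each other. \<open>trapped\<close>
  breaks the circle: it asks for the equation up to a time \<tau> only after confinement before
  \<tau>, which is enough to have \<sigma> = 0 on the open interval.\<close>

lemma solution_inside:
  assumes sol: "hsolution P z K" and c: "\<forall>z. near z \<and> \<not> inside z \<longrightarrow> c \<le> lyap z"
    and start: "fst (z (0, 0)) \<in> basin c" and t: "(t, 0) \<in> K"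
  shows "inside (z (t, 0))"
proof -
  have K: "hybrid_time_domain K" using sol by (simp add: hsolution_def)
  have t0: "0 \<le> t" "{0..t} \<subseteq> {s. (s, 0) \<in> K}" using hybrid_time_domain_slice[OF K t] by auto
  interpret S: solution_slice P z K t
    by unfold_locales (fact sol net t0(2))+
  have "inside (frozen z t)"
  proof (rule trapped[OF c, of t])
    show "inside (frozen z 0)" "lyap (frozen z 0) < c"
      using start by (simp_all only: basin_def frozen_def mem_Collect_eq)
    fix \<tau> :: real assume \<tau>: "0 < \<tau>" "\<tau> \<le> t" and ins: "\<And>s. s \<in> {0..<\<tau>} \<Longrightarrow> inside (frozen z s)"
    interpret S': solution_slice P z K \<tau> by (rule S.slice_subslice[OF \<tau>(2)])
    show "flows_on P (frozen z) {0..\<tau>}"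
    proof (rule S'.flows_on_frozen[OF \<tau>(1)])
      fix s j assume s: "s \<in> {0<..<\<tau>}" and j: "j \<in> buses P"
      have "z (s, 0) \<in> Cset P" using S'.interior_slice s by (intro S'.slice_props(4)) auto
      then show "sig (z (s, 0)) j = 0" using ins[of s] s j by (intro inside_sig_0) auto
    qed
  qed (use S.slice_cont S.slice_Ws t0 in simp_all)
  then show ?thesis by simp
qed

lemma local_convergence:
  assumes inv: "\<And>j C. \<lbrakk>j \<in> buses P; C \<subseteq> Ws P j; compact C; invariant_set (Ws P j) (\<lambda>x. fs P j x 0) C\<rbrakk>
      \<Longrightarrow> \<forall>x\<in>C. fs P j x 0 = 0"
    and sol: "hsolution P z K" and c: "\<forall>z. near z \<and> \<not> inside z \<longrightarrow> c \<le> lyap z"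
    and start: "fst (z (0, 0)) \<in> basin c" and \<epsilon>: "\<epsilon> > 0"
  shows "\<exists>T. \<forall>(t, l)\<in>K. T \<le> t + real l \<longrightarrow> (\<exists>w. equilibrium P w \<and> zdist P (z (t, l)) w < \<epsilon>)"
    and "j \<in> buses P \<Longrightarrow> \<exists>T. \<forall>(t, l)\<in>K. T \<le> t + real l \<longrightarrow> \<bar>omg (z (t, l)) j\<bar> < \<epsilon> \<and> sig (z (t, l)) j = 0"
proof -
  note ins = solution_inside[OF sol c start]
  have K: "hybrid_time_domain K" using sol by (simp add: hsolution_def)
  have "(\<exists>T. \<forall>(t, l)\<in>K. T \<le> t + real l \<longrightarrow> (\<exists>w. equilibrium P w \<and> zdist P (z (t, l)) w < \<epsilon>)) \<and>
    (\<forall>j\<in>buses P. \<exists>T. \<forall>(t, l)\<in>K. T \<le> t + real l \<longrightarrow> \<bar>omg (z (t, l)) j\<bar> < \<epsilon> \<and> sig (z (t, l)) j = 0)"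
    using hybrid_time_domain_cases[OF K]
  proof (elim disjE exE)
    fix t assume jump: "(t, 0) \<in> K \<and> (t, 1) \<in> K"
    have "z (t, 0) \<in> Dset P"
      using sol[unfolded hsolution_def, THEN conjunct2, THEN conjunct2, THEN conjunct2, THEN conjunct2,
          THEN spec, THEN spec, of t 0] jump by simp
    then show ?thesis using inside_not_Dset[OF ins] jump by blast
  next
    fix B assume bounded: "\<forall>t l. (t, l) \<in> K \<longrightarrow> t + real l \<le> B"
    \<comment> \<open>No point of the domain is this late, so both claims hold vacuously.\<close>
    have late: "\<not> B + 1 \<le> t + real l" if "(t, l) \<in> K" for t l using bounded[rule_format, OF that] by simp
    have "\<exists>T. \<forall>(t, l)\<in>K. T \<le> t + real l \<longrightarrow> Q t l" for Q
      by (intro exI[of _ "B + 1"]) (clarsimp simp: late)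
    then show ?thesis by simp
  next
    assume complete: "K = {0..} \<times> {0}"
    have slice: "solution_slice P z K b" for b
      using sol net by unfold_locales (auto simp: complete)
    have inK: "(t, 0) \<in> K \<longleftrightarrow> 0 \<le> t" for t by (simp add: complete)
    have sig0: "sig (z (t, 0)) j = 0" if "0 < t" "j \<in> buses P" for t j
    proof -
      \<comment> \<open>One unit more makes \<open>t\<close> an interior time.\<close>
      interpret S: solution_slice P z K "t + 1" by (rule slice)
      have "z (t, 0) \<in> Cset P" using S.interior_slice that by (intro S.slice_props(4)) auto
      then show ?thesis using ins[of t] that inK by (intro inside_sig_0) auto
    qed
    have near: "near (frozen z t)" if "0 \<le> t" for t
    proof (rule inside_imp_near)
      show "inside (frozen z t)" using ins inK that by simp
      interpret S: solution_slice P z K t by (rule slice)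
      show "xsv (frozen z t) j \<in> Ws P j" if "j \<in> buses P" for j
        using S.slice_Ws[of t j] that \<open>0 \<le> t\<close> by simp
    qed
    have fl: "flows_on P (frozen z) {0..}"
    proof (rule flows_on_all)
      fix b :: real assume b: "b > 0"
      interpret S: solution_slice P z K b by (rule slice)
      show "flows_on P (frozen z) {0..b}" by (rule S.flows_on_frozen[OF b]) (use sig0 in auto)
    qed
    interpret Z: trapped_trajectory P zs V V' R "frozen z"
    proof unfold_locales
      show "\<forall>x\<in>C. fs P j x 0 = 0" if "j \<in> buses P" "C \<subseteq> Ws P j" "compact C"
        "invariant_set (Ws P j) (\<lambda>x. fs P j x 0) C" for j C by (rule inv[OF that])
    qed (simp_all add: fl near)
    have zd: "zdist P (z (t, 0)) w = zdist P (frozen z t) w" if "0 < t" for t w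
      unfolding zdist_def using sig0[OF that] by simp
    show ?thesis
    proof (intro conjI ballI)
      from Z.converges_to_equilibria[OF \<epsilon>] obtain T where
        T: "\<forall>t\<ge>T. \<exists>w. equilibrium P w \<and> zdist P (frozen z t) w < \<epsilon>" ..
      show "\<exists>T. \<forall>(t, l)\<in>K. T \<le> t + real l \<longrightarrow> (\<exists>w. equilibrium P w \<and> zdist P (z (t, l)) w < \<epsilon>)"
      \<comment> \<open>The 1 makes \<open>t\<close> positive, so that \<open>sig0\<close> applies
        and the solution agrees with its frozen version.\<close>
      proof (intro exI[of _ "max T 1"], clarify)
        fix t l assume "(t, l) \<in> K" "max T 1 \<le> t + real l"
        then have "l = 0" "T \<le> t" "0 < t" by (auto simp: complete)
        then show "\<exists>w. equilibrium P w \<and> zdist P (z (t, l)) w < \<epsilon>" using T zd by simp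
      qed
    next
      fix j assume j: "j \<in> buses P"
      have "\<forall>\<^sub>F t in at_top. dist (omg (z (t, 0)) j) 0 < \<epsilon>"
        using tendstoD[OF Z.om_tendsto_0[OF j] \<epsilon>] by simp
      then obtain T where T: "\<forall>t\<ge>T. dist (omg (z (t, 0)) j) 0 < \<epsilon>"
        unfolding eventually_at_top_linorder ..
      show "\<exists>T. \<forall>(t, l)\<in>K. T \<le> t + real l \<longrightarrow> \<bar>omg (z (t, l)) j\<bar> < \<epsilon> \<and> sig (z (t, l)) j = 0"
      proof (intro exI[of _ "max T 1"], clarify)
        fix t l assume "(t, l) \<in> K" "max T 1 \<le> t + real l"
        then have "l = 0" "T \<le> t" "0 < t" by (auto simp: complete)
        then show "\<bar>omg (z (t, l)) j\<bar> < \<epsilon> \<and> sig (z (t, l)) j = 0"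
          using T sig0[OF _ j] by simp
      qed
    qed
  qed
  then show "\<exists>T. \<forall>(t, l)\<in>K. T \<le> t + real l \<longrightarrow> (\<exists>w. equilibrium P w \<and> zdist P (z (t, l)) w < \<epsilon>)"
    and "j \<in> buses P \<Longrightarrow> \<exists>T. \<forall>(t, l)\<in>K. T \<le> t + real l \<longrightarrow> \<bar>omg (z (t, l)) j\<bar> < \<epsilon> \<and> sig (z (t, l)) j = 0"
    by simp_all
qed

end

section \<open>Local convergence\<close>

lemma equilibrium_flow_zero:
  assumes "equilibrium P z"
  shows "z \<in> Cset P" "flow_eta P z = (\<lambda>_. 0)" "flow_om P z = (\<lambda>_. 0)" "flow_xs P z = (\<lambda>_. 0)"
proof -
  show C: "z \<in> Cset P" using assms Dset_subset_Cset unfolding equilibrium_def by blast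
  have "flowmap P z = ((\<lambda>_. 0, \<lambda>_. 0, \<lambda>_. 0), (\<lambda>_. 0))" using assms C unfolding equilibrium_def by simp
  then show "flow_eta P z = (\<lambda>_. 0)" "flow_om P z = (\<lambda>_. 0)" "flow_xs P z = (\<lambda>_. 0)"
    by (simp_all add: flowmap_def)
qed

text \<open>At an equilibrium the frequency is constant along edges, hence the same at all buses of the
  connected network; the bus given by (A2) forces it to vanish.\<close>

lemma equilibrium_omg_zero:
  assumes net: "network_ok P" and eq: "equilibrium P z"
    and A2: "\<exists>j\<in>buses P. \<forall>x\<in>Ws P j. \<forall>w::real. fs P j x (- w) = 0 \<longrightarrow> w = 0"
    and j: "j \<in> buses P"
  shows "omg z j = 0"
proof -
  note e = equilibrium_flow_zero[OF eq]
  from A2 obtain i where i: "i \<in> buses P" and A2i: "\<forall>x\<in>Ws P i. \<forall>w::real. fs P i x (- w) = 0 \<longrightarrow> w = 0" ..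
  have "xsv z i \<in> Ws P i"
    using e(1) i by (cases "fst z") (simp add: Cset_def state_space_def xsv_def)
  moreover have "fs P i (xsv z i) (- omg z i) = 0"
    using fun_cong[OF e(4), of i] i by (simp add: flow_xs_def)
  ultimately have "omg z i = 0" using A2i by blast
  have edge: "omg z a = omg z b" if "(a, b) \<in> edges P" for a b
    using fun_cong[OF e(2), of "(a, b)"] that by (simp add: flow_eta_def)
  have "(i, j) \<in> (edges P \<union> (edges P)\<inverse>)\<^sup>*" using net i j by (simp add: network_ok_def)
  then have "omg z j = omg z i"
    by (induction rule: rtrancl_induct) (use edge in auto)
  then show ?thesis using \<open>omg z i = 0\<close> by simp
qed

text \<open>Strict minimality and passivity with one common radius for state and input, on closed
  balls as compactness arguments require. The margin of passivity survives only through its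
  sign.\<close>

definition local_storage :: "'a::euclidean_space net \<Rightarrow> 'a hstate \<Rightarrow> nat \<Rightarrow> ('a \<Rightarrow> real) \<Rightarrow>
    ('a \<Rightarrow> 'a \<Rightarrow>\<^sub>L real) \<Rightarrow> real \<Rightarrow> bool" where
  "local_storage P zs j V V' r \<longleftrightarrow> r > 0 \<and>
     (\<forall>x. (V has_derivative blinfun_apply (V' x)) (at x)) \<and> continuous_on UNIV V' \<and>
     (\<forall>x\<in>Ws P j. x \<noteq> xsv zs j \<and> dist x (xsv zs j) \<le> r \<longrightarrow> V (xsv zs j) < V x) \<and>
     (\<forall>x\<in>Ws P j. \<forall>w. dist x (xsv zs j) \<le> r \<and> \<bar>w\<bar> \<le> r \<longrightarrow>
        blinfun_apply (V' x) (fs P j x (- w)) + w * (gs P j x (- w) - gs P j (xsv zs j) 0) \<le> 0 \<and>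
        (w \<noteq> 0 \<longrightarrow>
          blinfun_apply (V' x) (fs P j x (- w)) + w * (gs P j x (- w) - gs P j (xsv zs j) 0) < 0))"

lemma lisp_storage_imp_local_storage:
  assumes lisp: "lisp_storage (Ws P j) (fs P j) (gs P j) 0 (xsv zs j) V"
    and min: "strict_local_min_on (Ws P j) V (xsv zs j)"
  shows "\<exists>V' r. local_storage P zs j V V' r"
proof -
  from lisp[unfolded lisp_storage_def] obtain \<Omega> X \<phi> V' where L: "open \<Omega>" "0 \<in> \<Omega>"
    "openin (top_of_set (Ws P j)) X" "xsv zs j \<in> X"
    "\<forall>x. (V has_derivative blinfun_apply (V' x)) (at x)" "continuous_on UNIV V'" "posdef_fun \<phi>"
    "\<forall>u\<in>\<Omega>. \<forall>x\<in>X. blinfun_apply (V' x) (fs P j x u)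
            \<le> (u - 0) * (gs P j x u - gs P j (xsv zs j) 0) - \<phi> (u - 0)"
    by (elim exE conjE) (rule that)
  from L(1)[unfolded open_contains_ball, rule_format, OF L(2)]
  obtain d1 where d1: "d1 > 0 \<and> ball 0 d1 \<subseteq> \<Omega>" ..
  from L(3)[unfolded openin_contains_ball, THEN conjunct2, rule_format, OF L(4)]
  obtain d2 where d2: "0 < d2 \<and> ball (xsv zs j) d2 \<inter> Ws P j \<subseteq> X" ..
  from min[unfolded strict_local_min_on_def] obtain d3 where
    d3: "d3 > 0 \<and> (\<forall>x\<in>Ws P j. 0 < dist x (xsv zs j) \<and> dist x (xsv zs j) < d3 \<longrightarrow> V (xsv zs j) < V x)" ..
  \<comment> \<open>Halving puts the closed balls of radius \<open>r\<close> inside all three open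
    neighbourhoods.\<close>
  define r where "r = min d1 (min d2 d3) / 2"
  have r: "r > 0" "r < d1" "r < d2" "r < d3" using d1 d2 d3 by (auto simp: r_def)
  have pass: "blinfun_apply (V' x) (fs P j x (- w)) + w * (gs P j x (- w) - gs P j (xsv zs j) 0) \<le> - \<phi> (- w)"
    if x: "x \<in> Ws P j" "dist x (xsv zs j) \<le> r" and w: "\<bar>w\<bar> \<le> r" for x w
  proof -
    have "x \<in> ball (xsv zs j) d2 \<inter> Ws P j" using x r by (simp add: dist_commute)
    then have "x \<in> X" using d2 by blast
    moreover have "- w \<in> ball 0 d1" using w r by simp
    then have "- w \<in> \<Omega>" using d1 by blast
    ultimately have "blinfun_apply (V' x) (fs P j x (- w))
        \<le> (- w - 0) * (gs P j x (- w) - gs P j (xsv zs j) 0) - \<phi> (- w - 0)"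
      using L(8) by blast
    then show ?thesis by simp
  qed
  have \<phi>2: "\<phi> (- w) > 0" if "w \<noteq> 0" for w
    using L(7) that unfolding posdef_fun_def by simp
  have \<phi>1: "\<phi> (- w) \<ge> 0" for w
    using L(7) less_imp_le[OF \<phi>2[of w]] unfolding posdef_fun_def by (cases "w = 0") simp_all
  have "local_storage P zs j V V' r"
    unfolding local_storage_def
  proof (intro conjI ballI allI impI)
    fix x assume x: "x \<in> Ws P j"
    show "V (xsv zs j) < V x" if "x \<noteq> xsv zs j \<and> dist x (xsv zs j) \<le> r"
      using d3 x r that by simp
    fix w
    assume w: "dist x (xsv zs j) \<le> r \<and> \<bar>w\<bar> \<le> r"
    show "blinfun_apply (V' x) (fs P j x (- w)) + w * (gs P j x (- w) - gs P j (xsv zs j) 0) \<le> 0"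
      using pass[OF x, of w] w \<phi>1[of w] by linarith
    show "blinfun_apply (V' x) (fs P j x (- w)) + w * (gs P j x (- w) - gs P j (xsv zs j) 0) < 0" if "w \<noteq> 0"
      using pass[OF x, of w] w \<phi>2[OF that] by linarith
  qed (use L(5,6) r in simp_all)
  then show ?thesis by (intro exI)
qed

lemma common_radius:
  assumes "finite I" "\<And>i. i \<in> I \<Longrightarrow> r i > (0::real)"
  shows "\<exists>R>0. \<forall>i\<in>I. R < r i"
proof -
  define m where "m = Min (insert 1 (r ` I))"
  have m: "m > 0" using assms by (auto simp: m_def)
  have "m / 2 < r i" if "i \<in> I" for i
  proof -
    have "m \<le> r i" using assms(1) that by (auto simp: m_def)
    then show ?thesis using m by simp
  qed
  then show ?thesis using m by (intro exI[of _ "m / 2"]) simp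
qed

lemma passive_network_exists:
  assumes net: "network_ok P"
    and A2: "\<exists>j\<in>buses P. \<forall>x\<in>Ws P j. \<forall>w::real. fs P j x (- w) = 0 \<longrightarrow> w = 0"
    and eq: "equilibrium P zs"
    and A3: "\<forall>j\<in>buses P. \<exists>V. lisp_storage (Ws P j) (fs P j) (gs P j) 0 (xsv zs j) V \<and>
                  strict_local_min_on (Ws P j) V (xsv zs j)"
    and A4: "\<forall>e\<in>edges P. \<bar>eta zs e\<bar> < pi / 2"
  shows "\<exists>V V' R. passive_network P zs V V' R"
proof -
  note e = equilibrium_flow_zero[OF eq]
  have fin: "finite (buses P)" by (simp add: buses_def)
  have "edges P \<subseteq> buses P \<times> buses P" using net by (simp add: network_ok_def)
  then have finE: "finite (edges P)" by (rule finite_subset) (simp add: fin)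
  have om: "omg zs j = 0" if "j \<in> buses P" for j
    by (rule equilibrium_omg_zero[OF net eq A2 that])
  have xsW: "xsv zs j \<in> Ws P j" if "j \<in> buses P" for j
    using e(1) that by (cases "fst zs") (simp add: Cset_def state_space_def xsv_def)
  have nj: "Mc P j > 0" "0 < om0 P j" "om0 P j < om1 P j" if "j \<in> buses P" for j
    using net that by (simp_all add: network_ok_def)
  have bal: "- pLc P j + gs P j (xsv zs j) 0 - (\<Sum>k\<in>{k. (j, k) \<in> edges P}. pflow P zs (j, k))
       + (\<Sum>i\<in>{i. (i, j) \<in> edges P}. pflow P zs (i, j)) = 0" if j: "j \<in> buses P" for j
  proof -
    \<comment> \<open>Frequency 0 lies strictly below the lower threshold, which forces \<sigma> = 0
      and drops the load from the balance.\<close>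
    have "sig zs j = 0" using e(1) j nj[OF j] om[OF j] by (auto simp: Cset_def Iset_def)
    then show ?thesis using fun_cong[OF e(3), of j] j om[OF j] nj(1)[OF j] by (simp add: flow_om_def)
  qed
  \<comment> \<open>Storage function, derivative and radius are packed into one triple, so that a
    single choice over the buses suffices.\<close>
  have "\<forall>j\<in>buses P. \<exists>q. local_storage P zs j (fst q) (fst (snd q)) (snd (snd q))"
  proof
    fix j assume "j \<in> buses P"
    then obtain V where "lisp_storage (Ws P j) (fs P j) (gs P j) 0 (xsv zs j) V \<and>
        strict_local_min_on (Ws P j) V (xsv zs j)" using A3 by blast
    then obtain V' r where "local_storage P zs j V V' r" using lisp_storage_imp_local_storage by blast
    then show "\<exists>q. local_storage P zs j (fst q) (fst (snd q)) (snd (snd q))"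
      by (intro exI[of _ "(V, V', r)"]) simp
  qed
  from bchoice[OF this] obtain q where
    q: "\<forall>j\<in>buses P. local_storage P zs j (fst (q j)) (fst (snd (q j))) (snd (snd (q j)))" ..
  have ls: "local_storage P zs j (fst (q j)) (fst (snd (q j))) (snd (snd (q j)))" if "j \<in> buses P" for j
    using q that by blast
  \<comment> \<open>Including \<open>om0\<close> places the whole box below the lower
    thresholds.\<close>
  have r0: "min (snd (snd (q j))) (om0 P j) > 0" if "j \<in> buses P" for j
    using ls[OF that] nj(2)[OF that] by (simp add: local_storage_def)
  from common_radius[OF fin r0] obtain R1 where
    R1: "R1 > 0 \<and> (\<forall>j\<in>buses P. R1 < min (snd (snd (q j))) (om0 P j))" ..
  have e0: "pi / 2 - \<bar>eta zs e\<bar> > 0" if "e \<in> edges P" for e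
    using A4 that by simp
  from common_radius[OF finE e0] obtain R2 where
    R2: "R2 > 0 \<and> (\<forall>e\<in>edges P. R2 < pi / 2 - \<bar>eta zs e\<bar>)" ..
  define R where "R = min R1 R2"
  have R: "R \<le> snd (snd (q j))" "R < om0 P j" if "j \<in> buses P" for j
    using R1 that by (auto simp: R_def)
  have "passive_network P zs (\<lambda>j. fst (q j)) (\<lambda>j. fst (snd (q j))) R"
  proof
    show "R > 0" using R1 R2 by (simp add: R_def)
    show "\<bar>eta zs e\<bar> + R < pi / 2" if "e \<in> edges P" for e
    proof -
      have "R2 < pi / 2 - \<bar>eta zs e\<bar>" using R2 that by blast
      then show ?thesis by (simp add: R_def)
    qed
    fix j assume j: "j \<in> buses P"
    note l = ls[OF j, unfolded local_storage_def]
    note l1 = l[THEN conjunct2, THEN conjunct1] and l2 = l[THEN conjunct2, THEN conjunct2, THEN conjunct1]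
      and l3 = l[THEN conjunct2, THEN conjunct2, THEN conjunct2, THEN conjunct1]
      and l4 = l[THEN conjunct2, THEN conjunct2, THEN conjunct2, THEN conjunct2]
    show "(fst (q j) has_derivative blinfun_apply (fst (snd (q j)) x)) (at x)" for x using l1 ..
    show "continuous_on UNIV (fst (snd (q j)))" using l2 .
    show "fst (q j) (xsv zs j) < fst (q j) x"
      if "x \<in> Ws P j" "x \<noteq> xsv zs j" "dist x (xsv zs j) \<le> R" for x
      using l3 that R(1)[OF j] by simp
    show "blinfun_apply (fst (snd (q j)) x) (fs P j x (- w)) + w * (gs P j x (- w) - gs P j (xsv zs j) 0) \<le> 0"
      if "x \<in> Ws P j" "dist x (xsv zs j) \<le> R" "\<bar>w\<bar> \<le> R" for x w
      using l4 that R(1)[OF j] by simp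
    show "blinfun_apply (fst (snd (q j)) x) (fs P j x (- w)) + w * (gs P j x (- w) - gs P j (xsv zs j) 0) < 0"
      if "x \<in> Ws P j" "dist x (xsv zs j) \<le> R" "\<bar>w\<bar> \<le> R" "w \<noteq> 0" for x w
      using l4 that R(1)[OF j] by simp
  qed (use net om xsW bal R in simp_all)
  then show ?thesis by (intro exI)
qed

theorem theorem2:
  fixes P :: "'a::euclidean_space net" and zs :: "'a hstate"
  assumes net: "network_ok P"
    and A1i: "\<forall>j\<in>buses P. \<exists>x\<in>Ws P j. fs P j x 0 = 0"
    and A1ii: "\<forall>j\<in>buses P. \<forall>wbar::real. \<forall>K. K \<subseteq> Ws P j \<and> compact K \<and>
                  invariant_set (Ws P j) (\<lambda>x. fs P j x (- wbar)) K
                  \<longrightarrow> (\<forall>x\<in>K. fs P j x (- wbar) = 0)"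
    and A2: "\<exists>j\<in>buses P. \<forall>xbar\<in>Ws P j. \<forall>wbar::real.
                  fs P j xbar (- wbar) = 0 \<longrightarrow> wbar = 0"
    and eq: "equilibrium P zs"
    and A3: "\<forall>j\<in>buses P. \<exists>V. lisp_storage (Ws P j) (fs P j) (gs P j) 0 (xsv zs j) V \<and>
                  strict_local_min_on (Ws P j) V (xsv zs j)"
    and A4: "\<forall>e\<in>edges P. \<bar>eta zs e\<bar> < pi / 2"
  shows "\<exists>S. openin (top_of_set (state_space P)) S \<and> fst zs \<in> S \<and>
     (\<forall>z K. maximal_hsolution P z K \<and> fst (z (0, 0)) \<in> S \<and>
            (\<forall>j\<in>buses P. sig (z (0, 0)) j \<in> Iset P j (omg (z (0, 0)) j)) \<longrightarrow>
        (\<forall>\<epsilon>>0. \<exists>T. \<forall>(t, l)\<in>K. T \<le> t + real l \<longrightarrow>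
            (\<exists>w. equilibrium P w \<and> zdist P (z (t, l)) w < \<epsilon>)) \<and>
        (\<forall>j\<in>buses P. \<forall>\<epsilon>>0. \<exists>T. \<forall>(t, l)\<in>K. T \<le> t + real l \<longrightarrow>
            \<bar>omg (z (t, l)) j\<bar> < \<epsilon> \<and> sig (z (t, l)) j = 0))"
proof -
  from passive_network_exists[OF net A2 eq A3 A4] obtain V V' R where "passive_network P zs V V' R"
    by (elim exE) (rule that)
  then interpret passive_network P zs V V' R .
  have inv: "\<forall>x\<in>C. fs P j x 0 = 0"
    if "j \<in> buses P" "C \<subseteq> Ws P j" "compact C" "invariant_set (Ws P j) (\<lambda>x. fs P j x 0) C" for j C
    \<comment> \<open>The frequencies tend to 0, hence this instance.\<close>
    using A1ii[rule_format, of j C 0] that by simp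
  from lyap_boundary_bound obtain c where c: "c > 0 \<and> (\<forall>z. near z \<and> \<not> inside z \<longrightarrow> c \<le> lyap z)" ..
  \<comment> \<open>\<open>lyap\<close> vanishes at the equilibrium, so any positive barrier
    \<open>c\<close> leaves it in the sublevel set.\<close>
  have "fst zs \<in> basin c"
  proof -
    have zs: "eta (fst zs, \<lambda>_. 0) = eta zs" "omg (fst zs, \<lambda>_. 0) = omg zs" "xsv (fst zs, \<lambda>_. 0) = xsv zs"
      by (simp_all add: eta_def omg_def xsv_def)
    have "fst zs \<in> state_space P" using equilibrium_flow_zero(1)[OF eq] by (simp add: Cset_def)
    then show ?thesis
      using c om_eq R_pos by (simp add: basin_def inside_def lyap_def zs edge_energy_def)
  qed
  moreover have "openin (top_of_set (state_space P)) (basin c)" by (rule openin_basin)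
  ultimately show ?thesis
    using local_convergence[OF inv _ c[THEN conjunct2]]
    by (intro exI[of _ "basin c"]) (simp add: maximal_hsolution_def)
qed

end
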